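(* Let $\{z^{(k)}\}$ be the iterate sequence generated by PALM-I (described in the context, with $M_l=\gamma L$, $\gamma>1$, $M_u=M\ge M_l$), with $\varepsilon^{(k)}=\frac{\bar\varepsilon}{(k+1)^{\ell}}$ for all $k\ge 0$, where $\ell>1$. Suppose that: (1) for each $i=1,\ldots,n$ there is $L_i>0$ such that $\|\nabla_i f(z_1)-\nabla_i f(z_2)\|\le L_i\|z_1-z_2\|$ for all $z_1,z_2\in\prod_{j=1}^n\bar{\mathcal S}_j$; (2) for each $i=1,\ldots,n$, $\mathcal S_i$ is convex and compact, $h_i$ is linear or satisfies the Slater constraint qualification (there is $\hat x_i\in\mathbb R^{m_i}$ with $h_i(\hat x_i)<0$), and there is a constant $\tilde c_i\ge 0$ such that $\mathrm{dist}(x_i,\mathcal S_i)\le \tilde c_i\|\max\{h_i(x_i),0\}\|$ for all $x_i\in\tilde{\mathcal S}_i$; (3) $F$ has the Łojasiewicz property at each of its stationary points; (4) there exists $\bar\theta\in(0,1)$ such that $\{(e^{(k)})^{\bar\theta}\}$ is summable, where $e^{(k)}:=\sum_{t=k}^\infty(\varepsilon^{(t)})^2$, and $\{\varepsilon^{(k)}\}$ is summable. Let $\bar z$ be the unique limit point of $\{z^{(k)}\}$ and let $\theta\in[0,1)$ be the Łojasiewicz exponent of $F$ at $\bar z$. Assume that $v^{(k)}>\overline F$ for any $k\ge 0$, where $v^{(k)}$ and $\overline F$ are as defined in the context. Then, for all sufficiently large $k$, $$\|z^{(k)}-\bar z\|\le\begin{cases}\mathcal O\big(k^{-\frac{1-\theta}{2\theta-1}}\big),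 & \text{if }\ell\in\big[\tfrac{\theta}{2\theta-1},\infty\big)\text{ and }\theta\in(\tfrac12,1),\\[2pt] \mathcal O\big(k^{-(\ell-1)}\big), & \text{otherwise.}\end{cases}$$
   Context: Problem. $n,m_i,p_i$ are positive integers; $f:\prod_{i=1}^n\mathbb R^{m_i}\to\mathbb R$ is differentiable (not necessarily convex); for $i=1,\ldots,n$, $h_i=(h_{i,1},\ldots,h_{i,p_i})^\top:\mathbb R^{m_i}\to\mathbb R^{p_i}$ is convex and differentiable, and $\mathcal S_i:=\{w\in\mathbb R^{m_i}: h_i(w)\le 0\}$. Write $z=(x_1,\ldots,x_n)$ with $x_i\in\mathbb R^{m_i}$, and $F(z):=f(z)+\sum_{i=1}^n\delta_{\mathcal S_i}(x_i)$, where $\delta_{\mathcal S}$ is the indicator function ($0$ on $\mathcal S$, $+\infty$ off $\mathcal S$). $\nabla_i f$ is the gradient of $f$ with respect to $x_i$; $\nabla h_i(x_i)\in\mathbb R^{m_i\times p_i}$ has as columns the gradients of the components of $h_i$; $\|\cdot\|$ is the Euclidean norm; inequalities and $\max\{\cdot,0\}$ of vectors are componentwise; $\mathrm{dist}(w,\mathcal S)=\inf_{w'\in\mathcal S}\|w-w'\|$. $x_{<i}=(x_1,\ldots,x_{i-1})$, and similarly $x_{\ge i}$, etc. Residual. $r_i(x_i,\lambda_i,\tilde x_i):=\max\{\langle x_i,x_i-\tilde x_i+\nabla h_i(x_i)\lambda_i\rangle,0\}+\|x_i-\tilde x_i+\nabla h_i(x_i)\lambda_i\|_\infty+\|\max\{h_i(x_i),0\}\|_\infty+\max\{-\langle\lambda_i,h_i(x_i)\rangle,0\}$.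 PALM-I. Inputs: $z^{(0)}\in\prod_i\mathbb R^{m_i}$, $\bar\varepsilon>0$, a nonnegative sequence $\{\varepsilon^{(k)}\}$ with $\varepsilon^{(k)}\le\bar\varepsilon$, $M_u\ge M_l>0$, and $\sigma_i^{(0)}\in[M_l,M_u]$. For $k=0,1,2,\ldots$ and, successively, $i=1,\ldots,n$: put $\tilde x_i^{(k)}:=x_i^{(k)}-\frac{1}{\sigma_i^{(k)}}\nabla_i f(x_{<i}^{(k+1)},x_{\ge i}^{(k)})$; choose $x_i^{(k+1)}\in\mathbb R^{m_i}$ (not necessarily in $\mathcal S_i$) for which there is $\lambda_i^{(k+1)}\in\mathbb R_+^{p_i}$ with $\sqrt{r_i(x_i^{(k+1)},\lambda_i^{(k+1)},\tilde x_i^{(k)})}\le\varepsilon^{(k)}$; choose $\sigma_i^{(k+1)}\in[M_l,M_u]$. This generates $z^{(k)}=(x_1^{(k)},\ldots,x_n^{(k)})$. The exact subproblem solutions along the run are $\bar x_i^{(k+1)}:=\arg\min_{x_i\in\mathcal S_i}\langle\nabla_i f(x_{<i}^{(k+1)},x_{\ge i}^{(k)}),x_i-x_i^{(k)}\rangle+\frac{\sigma_i^{(k)}}{2}\|x_i-x_i^{(k)}\|^2$, with $\bar z^{(k)}:=(\bar x_1^{(k)},\ldots,\bar x_n^{(k)})$ for $k\ge1$, and $\Delta z^{(k)}:=\bar z^{(k)}-z^{(k)}$. Convention: $\bar z^{(0)}$ is an arbitrary fixed point of $\prod_i\mathcal S_i$. Further notation. $\bar{\mathcal S}_i:=\{w\in\mathbb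 R^{m_i}:\mathrm{dist}(w,\mathcal S_i)\le\bar\varepsilon\}$; $\bar{\mathcal M}_i:=\sup_{z\in\prod_j\bar{\mathcal S}_j}\|\nabla_i f(z)\|$; $\tilde{\mathcal S}_i:=\{w\in\mathbb R^{m_i}:\mathrm{dist}(w,\bar{\mathcal S}_i)\le\bar{\mathcal M}_i/M_l\}$. $L:=\max_i L_i$; the algorithm is run with $M_l=\gamma L$ for some $\gamma>1$ and $M_u=M$ any scalar with $M\ge M_l$. $\nu:=\frac{12}{\gamma-1}$, $\bar\sigma^{(k)}:=\max_i\sigma_i^{(k)}$, $C_1^{(k)}:=\frac12\big(\bar\sigma^{(k)}+L[\frac{\nu}{2}n^2+(2+\frac{2}{\nu}-\frac{\nu}{2})n+2\nu+\frac{4}{\nu}+3]\big)$, $u^{(k)}:=\sum_{t=k}^\infty C_1^{(t)}\|\Delta z^{(t)}\|^2$, $v^{(k)}:=F(\bar z^{(k)})+u^{(k)}+u^{(k+1)}$. Under hypotheses (1), (2), (4) the sequence $\{v^{(k)}\}$ is well defined and converges; $\overline F$ denotes its limit. Under hypotheses (1)–(4) the sequence $\{z^{(k)}\}$ converges to a stationary point of $F$. "$a_k\le\mathcal O(b_k)$ for all sufficiently large $k$" means there is a constant $C$ (independent of $k$) with $a_k\le Cb_k$ for all sufficiently large $k$. Subdifferential and Łojasiewicz property. For a proper closed $G:\mathbb E\to(-\infty,\infty]$ on a Euclidean space and $x\in\mathrm{dom}(G)$, $\partial G(x):=\{u\in\mathbb E:\liminf_{y\ne x,y\to x}\frac{G(y)-G(x)-\langle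 u,y-x\rangle}{\|y-x\|}\ge 0\}$ (Fréchet subdifferential), and $\partial G(x)=\emptyset$ otherwise. $x$ is a stationary point of $G$ if $0\in\partial G(x)$. $G$ has the Łojasiewicz property at a stationary point $\bar x$ if there are $c>0$, $\theta\in[0,1)$, $\eta>0$ such that $|G(x)-G(\bar x)|^\theta\le c\cdot\mathrm{dist}(0,\partial G(x))$ for all $x$ in the closed ball of radius $\eta$ around $\bar x$, with the convention $0^0=0$ if $\theta=0$ (so $|G(x)-G(\bar x)|^0=0$ means $G(x)=G(\bar x)$); $\theta$ is the Łojasiewicz exponent of $G$ at $\bar x$. *)

theory Defs
  imports "HOL-Analysis.Analysis"
begin

text \<open>
  The product of the spaces \<open>R^{m_1}, ..., R^{m_n}\<close> is the Euclidean space \<open>real ^ 'd\<close>, whose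
  coordinates are distributed over the blocks \<open>1, ..., n\<close> by a map \<open>b :: 'd \<Rightarrow> nat\<close>.  The factor
  \<open>R^{m_i}\<close> is identified, isometrically, with the coordinate subspace \<open>blockspace b i\<close>, and
  the component \<open>x_i\<close> of \<open>z\<close> with \<open>blockpart b i z\<close>.  As \<open>'d\<close> and \<open>b\<close> are arbitrary, every
  choice of \<open>n\<close> and \<open>m_1, ..., m_n\<close> is covered.  Vectors of \<open>R^{p_i}\<close> are functions on \<open>{1..p i}\<close>.
\<close>

definition block_structure :: "('d::finite \<Rightarrow> nat) \<Rightarrow> nat \<Rightarrow> (nat \<Rightarrow> nat) \<Rightarrow> bool" where
  "block_structure b n m \<longleftrightarrow>
     0 < n \<and> (\<forall>d. b d \<in> {1..n}) \<and> (\<forall>i\<in>{1..n}. 0 < m i \<and> card {d. b d = i} = m i)"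

definition blockspace :: "('d::finite \<Rightarrow> nat) \<Rightarrow> nat \<Rightarrow> (real ^ 'd) set" where
  "blockspace b i = {w. \<forall>d. b d \<noteq> i \<longrightarrow> w $ d = 0}"

definition blockpart :: "('d::finite \<Rightarrow> nat) \<Rightarrow> nat \<Rightarrow> real ^ 'd \<Rightarrow> real ^ 'd" where
  "blockpart b i z = (\<chi> d. if b d = i then z $ d else 0)"

definition blockprod :: "('d::finite \<Rightarrow> nat) \<Rightarrow> nat \<Rightarrow> (nat \<Rightarrow> (real ^ 'd) set) \<Rightarrow> (real ^ 'd) set" where
  "blockprod b n A = {z. \<forall>i\<in>{1..n}. blockpart b i z \<in> A i}"

text \<open>\<open>mixed b i y z\<close> has the blocks of \<open>y\<close> below \<open>i\<close> and those of \<open>z\<close> from \<open>i\<close> on.\<close>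

definition mixed :: "('d::finite \<Rightarrow> nat) \<Rightarrow> nat \<Rightarrow> real ^ 'd \<Rightarrow> real ^ 'd \<Rightarrow> real ^ 'd" where
  "mixed b i y z = (\<chi> d. if b d < i then y $ d else z $ d)"

text \<open>Gradient of a function on a linear subspace \<open>V\<close>; requiring \<open>g \<in> V\<close> makes it unique.\<close>

definition grad_in :: "'a::euclidean_space set \<Rightarrow> ('a \<Rightarrow> real) \<Rightarrow> 'a \<Rightarrow> 'a" where
  "grad_in V \<phi> x = (THE g. g \<in> V \<and> (\<phi> has_derivative (\<lambda>v. g \<bullet> v)) (at x within V))"

definition partial_grad ::
    "('d::finite \<Rightarrow> nat) \<Rightarrow> (real ^ 'd \<Rightarrow> real) \<Rightarrow> nat \<Rightarrow> real ^ 'd \<Rightarrow> real ^ 'd" where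
  "partial_grad b f i z =
     grad_in (blockspace b i) (\<lambda>w. f (z - blockpart b i z + w)) (blockpart b i z)"

definition feas ::
    "('d::finite \<Rightarrow> nat) \<Rightarrow> (nat \<Rightarrow> nat) \<Rightarrow> (nat \<Rightarrow> nat \<Rightarrow> real ^ 'd \<Rightarrow> real) \<Rightarrow> nat \<Rightarrow> (real ^ 'd) set" where
  "feas b p h i = {w \<in> blockspace b i. \<forall>j\<in>{1..p i}. h i j w \<le> 0}"

definition delta :: "'a set \<Rightarrow> 'a \<Rightarrow> ereal" where
  "delta S w = (if w \<in> S then 0 else \<infinity>)"

definition objF ::
    "('d::finite \<Rightarrow> nat) \<Rightarrow> nat \<Rightarrow> (nat \<Rightarrow> nat) \<Rightarrow> (real ^ 'd \<Rightarrow> real) \<Rightarrow>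
     (nat \<Rightarrow> nat \<Rightarrow> real ^ 'd \<Rightarrow> real) \<Rightarrow> real ^ 'd \<Rightarrow> ereal" where
  "objF b n p f h z = ereal (f z) + (\<Sum>i\<in>{1..n}. delta (feas b p h i) (blockpart b i z))"

definition frechet_subdiff :: "('a::euclidean_space \<Rightarrow> ereal) \<Rightarrow> 'a \<Rightarrow> 'a set" where
  "frechet_subdiff G x =
     (if G x < \<infinity>
      then {u. 0 \<le> Liminf (at x) (\<lambda>y. (G y - G x - ereal (u \<bullet> (y - x))) / ereal (norm (y - x)))}
      else {})"

definition stationary :: "('a::euclidean_space \<Rightarrow> ereal) \<Rightarrow> 'a \<Rightarrow> bool" where
  "stationary G x \<longleftrightarrow> 0 \<in> frechet_subdiff G x"

text \<open>
  The infimum below is the distance from \<open>0\<close> to the subdifferential, in \<open>ereal\<close> so that the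
  distance to the empty set is \<open>\<infinity>\<close>; hence the inequality is void at points outside the domain
  of \<open>G\<close>.  Since \<open>0 powr 0 = 0\<close>, exponent \<open>0\<close> follows the convention \<open>0^0 = 0\<close>.
\<close>

definition loj_exponent :: "('a::euclidean_space \<Rightarrow> ereal) \<Rightarrow> 'a \<Rightarrow> real \<Rightarrow> bool" where
  "loj_exponent G x \<theta> \<longleftrightarrow> 0 \<le> \<theta> \<and> \<theta> < 1 \<and>
     (\<exists>c>0. \<exists>\<eta>>0. \<forall>y\<in>cball x \<eta>.
        ereal (real_of_ereal \<bar>G y - G x\<bar> powr \<theta>)
          \<le> ereal c * (INF u\<in>frechet_subdiff G y. ereal (norm u)))"

definition loj_property :: "('a::euclidean_space \<Rightarrow> ereal) \<Rightarrow> 'a \<Rightarrow> bool" where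
  "loj_property G x \<longleftrightarrow> (\<exists>\<theta>. loj_exponent G x \<theta>)"

definition residual ::
    "('d::finite \<Rightarrow> nat) \<Rightarrow> (nat \<Rightarrow> nat) \<Rightarrow> (nat \<Rightarrow> nat \<Rightarrow> real ^ 'd \<Rightarrow> real) \<Rightarrow> nat \<Rightarrow>
     real ^ 'd \<Rightarrow> (nat \<Rightarrow> real) \<Rightarrow> real ^ 'd \<Rightarrow> real" where
  "residual b p h i x lam xt =
     (let w = x - xt + (\<Sum>j\<in>{1..p i}. lam j *\<^sub>R grad_in (blockspace b i) (h i j) x)
      in max (x \<bullet> w) 0 + infnorm w
         + Max ((\<lambda>j. \<bar>max (h i j x) 0\<bar>) ` {1..p i})
         + max (- (\<Sum>j\<in>{1..p i}. lam j * h i j x)) 0)"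

definition palm_grad ::
    "('d::finite \<Rightarrow> nat) \<Rightarrow> (real ^ 'd \<Rightarrow> real) \<Rightarrow> (nat \<Rightarrow> real ^ 'd) \<Rightarrow> nat \<Rightarrow> nat \<Rightarrow> real ^ 'd" where
  "palm_grad b f z k i = partial_grad b f i (mixed b i (z (Suc k)) (z k))"

definition palm_center ::
    "('d::finite \<Rightarrow> nat) \<Rightarrow> (real ^ 'd \<Rightarrow> real) \<Rightarrow> (nat \<Rightarrow> nat \<Rightarrow> real) \<Rightarrow> (nat \<Rightarrow> real ^ 'd) \<Rightarrow>
     nat \<Rightarrow> nat \<Rightarrow> real ^ 'd" where
  "palm_center b f \<sigma> z k i = blockpart b i (z k) - (1 / \<sigma> k i) *\<^sub>R palm_grad b f z k i"

text \<open>\<open>z\<close> and \<open>\<sigma>\<close> (with \<open>\<sigma> k i\<close> the step parameter of block \<open>i\<close>) form a run of PALM-I.\<close>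

definition palm_run ::
    "('d::finite \<Rightarrow> nat) \<Rightarrow> nat \<Rightarrow> (nat \<Rightarrow> nat) \<Rightarrow> (real ^ 'd \<Rightarrow> real) \<Rightarrow>
     (nat \<Rightarrow> nat \<Rightarrow> real ^ 'd \<Rightarrow> real) \<Rightarrow> real \<Rightarrow> real \<Rightarrow> (nat \<Rightarrow> real) \<Rightarrow>
     (nat \<Rightarrow> real ^ 'd) \<Rightarrow> (nat \<Rightarrow> nat \<Rightarrow> real) \<Rightarrow> bool" where
  "palm_run b n p f h Ml Mu \<epsilon> z \<sigma> \<longleftrightarrow>
     (\<forall>k. \<forall>i\<in>{1..n}. \<sigma> k i \<in> {Ml..Mu} \<and>
        (\<exists>lam. (\<forall>j\<in>{1..p i}. 0 \<le> lam j) \<and>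
           sqrt (residual b p h i (blockpart b i (z (Suc k))) lam (palm_center b f \<sigma> z k i)) \<le> \<epsilon> k))"

text \<open>
  The exact subproblem solutions along the run, started at \<open>zb0\<close>; the sum over \<open>i\<close> assembles the
  point whose \<open>i\<close>-th block is the \<open>i\<close>-th minimiser.
\<close>

fun palm_exact ::
    "('d::finite \<Rightarrow> nat) \<Rightarrow> nat \<Rightarrow> (nat \<Rightarrow> nat) \<Rightarrow> (real ^ 'd \<Rightarrow> real) \<Rightarrow>
     (nat \<Rightarrow> nat \<Rightarrow> real ^ 'd \<Rightarrow> real) \<Rightarrow> (nat \<Rightarrow> real ^ 'd) \<Rightarrow> (nat \<Rightarrow> nat \<Rightarrow> real) \<Rightarrow>
     real ^ 'd \<Rightarrow> nat \<Rightarrow> real ^ 'd" where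
  "palm_exact b n p f h z \<sigma> zb0 0 = zb0"
| "palm_exact b n p f h z \<sigma> zb0 (Suc k) =
     (\<Sum>i\<in>{1..n}. arg_min
        (\<lambda>x. palm_grad b f z k i \<bullet> (x - blockpart b i (z k))
              + \<sigma> k i / 2 * (norm (x - blockpart b i (z k)))\<^sup>2)
        (\<lambda>x. x \<in> feas b p h i))"

definition feas_bar ::
    "('d::finite \<Rightarrow> nat) \<Rightarrow> (nat \<Rightarrow> nat) \<Rightarrow> (nat \<Rightarrow> nat \<Rightarrow> real ^ 'd \<Rightarrow> real) \<Rightarrow> real \<Rightarrow>
     nat \<Rightarrow> (real ^ 'd) set" where
  "feas_bar b p h \<epsilon>bar i = {w \<in> blockspace b i. infdist w (feas b p h i) \<le> \<epsilon>bar}"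

definition grad_bound ::
    "('d::finite \<Rightarrow> nat) \<Rightarrow> nat \<Rightarrow> (nat \<Rightarrow> nat) \<Rightarrow> (real ^ 'd \<Rightarrow> real) \<Rightarrow>
     (nat \<Rightarrow> nat \<Rightarrow> real ^ 'd \<Rightarrow> real) \<Rightarrow> real \<Rightarrow> nat \<Rightarrow> real" where
  "grad_bound b n p f h \<epsilon>bar i =
     (SUP z\<in>blockprod b n (feas_bar b p h \<epsilon>bar). norm (partial_grad b f i z))"

definition feas_tilde ::
    "('d::finite \<Rightarrow> nat) \<Rightarrow> nat \<Rightarrow> (nat \<Rightarrow> nat) \<Rightarrow> (real ^ 'd \<Rightarrow> real) \<Rightarrow>
     (nat \<Rightarrow> nat \<Rightarrow> real ^ 'd \<Rightarrow> real) \<Rightarrow> real \<Rightarrow> real \<Rightarrow> nat \<Rightarrow> (real ^ 'd) set" where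
  "feas_tilde b n p f h \<epsilon>bar Ml i =
     {w \<in> blockspace b i.
        infdist w (feas_bar b p h \<epsilon>bar i) \<le> grad_bound b n p f h \<epsilon>bar i / Ml}"

text \<open>``Linear'' constraints are affine functions, as usual in optimisation.\<close>

definition affine_constraint ::
    "('d::finite \<Rightarrow> nat) \<Rightarrow> (nat \<Rightarrow> nat) \<Rightarrow> (nat \<Rightarrow> nat \<Rightarrow> real ^ 'd \<Rightarrow> real) \<Rightarrow> nat \<Rightarrow> bool" where
  "affine_constraint b p h i \<longleftrightarrow>
     (\<forall>j\<in>{1..p i}. \<exists>a \<beta>. \<forall>w\<in>blockspace b i. h i j w = a \<bullet> w + \<beta>)"

definition slater ::
    "('d::finite \<Rightarrow> nat) \<Rightarrow> (nat \<Rightarrow> nat) \<Rightarrow> (nat \<Rightarrow> nat \<Rightarrow> real ^ 'd \<Rightarrow> real) \<Rightarrow> nat \<Rightarrow> bool" where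
  "slater b p h i \<longleftrightarrow> (\<exists>w\<in>blockspace b i. \<forall>j\<in>{1..p i}. h i j w < 0)"

definition palm_C1 :: "nat \<Rightarrow> real \<Rightarrow> real \<Rightarrow> (nat \<Rightarrow> nat \<Rightarrow> real) \<Rightarrow> nat \<Rightarrow> real" where
  "palm_C1 n L \<gamma> \<sigma> k =
     (let \<nu> = 12 / (\<gamma> - 1)
      in 1 / 2 * (Max (\<sigma> k ` {1..n})
           + L * (\<nu> / 2 * (real n)\<^sup>2 + (2 + 2 / \<nu> - \<nu> / 2) * real n + 2 * \<nu> + 4 / \<nu> + 3)))"

definition palm_u ::
    "nat \<Rightarrow> real \<Rightarrow> real \<Rightarrow> (nat \<Rightarrow> nat \<Rightarrow> real) \<Rightarrow> (nat \<Rightarrow> 'a::real_normed_vector) \<Rightarrow>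
     (nat \<Rightarrow> 'a) \<Rightarrow> nat \<Rightarrow> real" where
  "palm_u n L \<gamma> \<sigma> z zb k =
     (\<Sum>t. palm_C1 n L \<gamma> \<sigma> (k + t) * (norm (zb (k + t) - z (k + t)))\<^sup>2)"

definition palm_v ::
    "nat \<Rightarrow> real \<Rightarrow> real \<Rightarrow> (nat \<Rightarrow> nat \<Rightarrow> real) \<Rightarrow> ('a::real_normed_vector \<Rightarrow> ereal) \<Rightarrow>
     (nat \<Rightarrow> 'a) \<Rightarrow> (nat \<Rightarrow> 'a) \<Rightarrow> nat \<Rightarrow> ereal" where
  "palm_v n L \<gamma> \<sigma> F z zb k =
     F (zb k) + ereal (palm_u n L \<gamma> \<sigma> z zb k) + ereal (palm_u n L \<gamma> \<sigma> z zb (Suc k))"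

definition seq_limit_point :: "(nat \<Rightarrow> 'a::topological_space) \<Rightarrow> 'a \<Rightarrow> bool" where
  "seq_limit_point X l \<longleftrightarrow> (\<exists>r. strict_mono r \<and> (X \<circ> r) \<longlonglongrightarrow> l)"

end

theory Submission
  imports Defs
begin

text \<open>
  The proof follows the exact solutions \<open>zb k\<close> rather than the iterates \<open>z k\<close>; write \<open>step k\<close> for
  \<open>norm (zb (Suc k) - zb k)\<close>.  It has two halves.

  The first half shows that inexactness is a perturbation of order \<open>k powr - l\<close>.  The residual bounds
  the constraint violation, and an error bound for convex constraints that holds near the
  feasible set holds everywhere (\<open>error_bound_extends\<close>).  So the iterates eventually lie in the enlarged
  set where the partial gradients are Lipschitz and bounded, and there the approximate KKT conditions
  give \<open>norm (zb k - z k) = O(k powr - l)\<close> (\<open>inexact_projection\<close>, \<open>exact_distance\<close>).  Together with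
  the variational inequalities of the subproblems this yields a perturbed descent,
  \<open>f (zb (Suc k)) + \<kappa> * (step k)\<^sup>2 \<le> f (zb k) + O(k powr - (2 * l))\<close> (\<open>sufficient_descent\<close>), and a subgradient
  of the objective at \<open>zb (Suc k)\<close> of norm \<open>O(step k + k powr - l)\<close> (\<open>small_subgradient\<close>).  Adding to
  \<open>f (zb k) - f zlim\<close> a term of order \<open>k powr - (2 * l - 1)\<close> that absorbs all later perturbations gives
  a sequence \<open>a\<close> that decreases to 0.

  The second half is about real sequences (\<open>lojasiewicz_rate\<close>).  Put \<open>q = \<Theta> / (2 * \<Theta> - 1)\<close> for an
  exponent \<open>\<Theta>\<close> in \<open>(1/2, 1)\<close>.  If \<open>q \<le> l\<close>, the Lojasiewicz inequality with exponent \<open>\<Theta>\<close> becomes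
  \<open>a (Suc k) powr \<Theta> \<le> c * (step k + k powr - q)\<close>.  Squared and combined with
  \<open>\<kappa> * (step k)\<^sup>2 \<le> a k - a (Suc k)\<close> it is a recursion that forces \<open>a k = O(k powr - (2 * q - 1))\<close>.
  Cauchy-Schwarz on the indices from \<open>k\<close> to \<open>2 * k\<close> then bounds \<open>norm (zb (2 * k) - zb k)\<close> by
  \<open>sqrt (k * a k / \<kappa>) = O(k powr - (q - 1))\<close>, and these dyadic distances sum to a geometric series.

  Both cases of the theorem are instances.  In the first, \<open>\<Theta> = \<theta>\<close> is admissible and
  \<open>q - 1 = (1 - \<theta>) / (2 * \<theta> - 1)\<close>.  In the second, \<open>\<theta>\<close> is at most \<open>l / (2 * l - 1)\<close>; near the limit the
  Lojasiewicz inequality holds with every larger exponent, and \<open>\<Theta> = l / (2 * l - 1)\<close> is the one with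
  \<open>q = l\<close>.
\<close>

section \<open>Coordinate blocks\<close>

lemma subspace_blockspace: "subspace (blockspace b i)"
  by (auto simp: subspace_def blockspace_def)

lemma blockpart_in_blockspace [simp]: "blockpart b i x \<in> blockspace b i"
  by (auto simp: blockspace_def blockpart_def)

lemma blockpart_same: "w \<in> blockspace b i \<Longrightarrow> blockpart b i w = w"
  by (auto simp: blockspace_def blockpart_def vec_eq_iff)

lemma blockpart_other: "w \<in> blockspace b j \<Longrightarrow> j \<noteq> i \<Longrightarrow> blockpart b i w = 0"
  by (auto simp: blockspace_def blockpart_def vec_eq_iff)

lemma linear_blockpart: "linear (blockpart b i)"
  by (rule linearI) (auto simp: blockpart_def vec_eq_iff)

lemmas blockpart_simps =
  linear_add[OF linear_blockpart] linear_diff[OF linear_blockpart]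
  linear_scale[OF linear_blockpart] linear_0[OF linear_blockpart]

lemma blockpart_inner: "blockpart b i x \<bullet> y = blockpart b i x \<bullet> blockpart b i y"
  unfolding inner_vec_def blockpart_def by (intro sum.cong) auto

lemma norm_blockpart_le: "norm (blockpart b i x) \<le> norm x"
  by (rule norm_le_componentwise_cart) (auto simp: blockpart_def)

lemma sum_blockpart:
  assumes "\<forall>d. b d \<in> {1..n}"
  shows "(\<Sum>i\<in>{1..n}. blockpart b i x) = x"
  using assms by (auto simp: vec_eq_iff blockpart_def)

lemma norm_power2_blockparts:
  assumes "\<forall>d. b d \<in> {1..n}"
  shows "(norm x)\<^sup>2 = (\<Sum>i\<in>{1..n}. (norm (blockpart b i x))\<^sup>2)"
proof -
  have "(norm x)\<^sup>2 = (\<Sum>i\<in>{1..n}. blockpart b i x) \<bullet> x"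
    using sum_blockpart[OF assms] by (simp add: power2_norm_eq_inner)
  also have "\<dots> = (\<Sum>i\<in>{1..n}. (norm (blockpart b i x))\<^sup>2)"
    by (simp add: inner_sum_left power2_norm_eq_inner blockpart_inner[symmetric])
  finally show ?thesis .
qed

lemma norm_le_sum_blockparts:
  assumes "\<forall>d. b d \<in> {1..n}"
  shows "norm x \<le> (\<Sum>i\<in>{1..n}. norm (blockpart b i x))"
  using norm_sum[of "\<lambda>i. blockpart b i x" "{1..n}"] sum_blockpart[OF assms] by simp

lemma blockpart_mixed:
  "blockpart b i (mixed b j y z) = (if i < j then blockpart b i y else blockpart b i z)"
  by (auto simp: blockpart_def mixed_def vec_eq_iff)

lemma norm_mixed_le: "norm (mixed b i y z) \<le> norm y + norm z"
proof -
  have "mixed b i y z = mixed b i y 0 + mixed b i 0 z"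
    by (auto simp: mixed_def vec_eq_iff)
  then have "norm (mixed b i y z) \<le> norm (mixed b i y 0) + norm (mixed b i 0 z)"
    by (simp add: norm_triangle_ineq)
  also have "norm (mixed b i y 0) \<le> norm y"
    by (rule norm_le_componentwise_cart) (auto simp: mixed_def)
  also have "norm (mixed b i 0 z) \<le> norm z"
    by (rule norm_le_componentwise_cart) (auto simp: mixed_def)
  finally show ?thesis by simp
qed

lemma mixed_diff: "mixed b i (y - y') (z - z') = mixed b i y z - mixed b i y' z'"
  by (auto simp: mixed_def vec_eq_iff)

section \<open>Gradients on subspaces\<close>

text \<open>
  Difference quotients within a subspace only see increments from that subspace, so the derivative
  may be changed freely off it.  This is why gradients on a subspace are normalised to lie in it.
\<close>

lemma has_derivative_within_subspace_cong:
  assumes "subspace V" "x \<in> V" "(\<phi> has_derivative D) (at x within V)"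
    and "bounded_linear D'" "\<And>v. v \<in> V \<Longrightarrow> D' v = D v"
  shows "(\<phi> has_derivative D') (at x within V)"
proof -
  have "((\<lambda>y. (1 / norm (y - x)) *\<^sub>R (\<phi> y - (\<phi> x + D (y - x)))) \<longlongrightarrow> 0) (at x within V)"
    using assms(3) by (simp add: has_derivative_within)
  moreover have "\<forall>\<^sub>F y in at x within V. (1 / norm (y - x)) *\<^sub>R (\<phi> y - (\<phi> x + D (y - x)))
      = (1 / norm (y - x)) *\<^sub>R (\<phi> y - (\<phi> x + D' (y - x)))"
    unfolding eventually_at_filter using assms by (auto intro!: always_eventually simp: subspace_diff)
  ultimately show ?thesis
    using assms(4) by (simp add: has_derivative_within tendsto_cong)
qed

lemma has_derivative_along_line:
  assumes "subspace V" "x \<in> V" "v \<in> V" "(\<phi> has_derivative D) (at x within V)"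
  shows "((\<lambda>t::real. \<phi> (x + t *\<^sub>R v)) has_derivative (\<lambda>t. D (t *\<^sub>R v))) (at 0)"
proof -
  have 1: "((\<lambda>t::real. x + t *\<^sub>R v) has_derivative (\<lambda>t. t *\<^sub>R v)) (at 0)"
    by (auto intro!: derivative_eq_intros)
  have "range (\<lambda>t::real. x + t *\<^sub>R v) \<subseteq> V"
    using assms by (auto intro: subspace_add subspace_scale)
  then have "(\<phi> has_derivative D) (at (x + 0 *\<^sub>R v) within range (\<lambda>t::real. x + t *\<^sub>R v))"
    using assms(4) by (auto intro: has_derivative_subset)
  from has_derivative_in_compose[OF 1 this] show ?thesis by (simp add: o_def)
qed

lemma grad_in_eqI:
  assumes V: "subspace V" and x: "x \<in> V" and g: "g \<in> V"
    and D: "(\<phi> has_derivative (\<lambda>v. g \<bullet> v)) (at x within V)"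
  shows "grad_in V \<phi> x = g"
  unfolding grad_in_def
proof (rule the_equality)
  show "g \<in> V \<and> (\<phi> has_derivative (\<lambda>v. g \<bullet> v)) (at x within V)" using g D by simp
next
  fix g' assume g': "g' \<in> V \<and> (\<phi> has_derivative (\<lambda>v. g' \<bullet> v)) (at x within V)"
  have "g' - g \<in> V" using g g' V by (simp add: subspace_diff)
  with V x D g' have "(\<lambda>t::real. g \<bullet> (t *\<^sub>R (g' - g))) = (\<lambda>t. g' \<bullet> (t *\<^sub>R (g' - g)))"
    by (intro has_derivative_unique[OF has_derivative_along_line has_derivative_along_line]) auto
  then have "g \<bullet> (g' - g) = g' \<bullet> (g' - g)" by (metis scaleR_one)
  then have "(g' - g) \<bullet> (g' - g) = 0" by (simp add: inner_diff_left)
  then show "g' = g" by simp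
qed

text \<open>
  The Riesz representative of the derivative need not lie in \<open>V\<close>, but its orthogonal projection
  to \<open>V\<close> has the same inner products with increments from \<open>V\<close>.
\<close>

lemma grad_in_props:
  fixes V :: "'a::euclidean_space set"
  assumes V: "subspace V" and x: "x \<in> V" and d: "\<phi> differentiable (at x within V)"
  shows "grad_in V \<phi> x \<in> V"
    and "(\<phi> has_derivative (\<lambda>v. grad_in V \<phi> x \<bullet> v)) (at x within V)"
proof -
  obtain D where D: "(\<phi> has_derivative D) (at x within V)" using d by (auto simp: differentiable_def)
  interpret D: bounded_linear D using D by (rule has_derivative_bounded_linear)
  define a where "a = (\<Sum>e\<in>Basis. D e *\<^sub>R e)"
  have a: "a \<bullet> v = D v" for v
  proof -
    have "D v = D (\<Sum>e\<in>Basis. (v \<bullet> e) *\<^sub>R e)" by (simp add: euclidean_representation)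
    also have "\<dots> = a \<bullet> v" unfolding a_def
      by (simp add: D.sum D.scaleR inner_sum_left inner_commute[of v] mult.commute)
    finally show ?thesis by simp
  qed
  obtain g r where g: "g \<in> span V" and r: "\<And>w. w \<in> span V \<Longrightarrow> orthogonal r w" and e: "a = g + r"
    using orthogonal_subspace_decomp_exists[of V a] by metis
  have gV: "g \<in> V" using g V by (metis span_eq_iff)
  have "g \<bullet> v = D v" if "v \<in> V" for v
    using r[of v] that V a[of v] e by (simp add: span_base orthogonal_def inner_add_left)
  then have g': "(\<phi> has_derivative (\<lambda>v. g \<bullet> v)) (at x within V)"
    by (intro has_derivative_within_subspace_cong[OF V x D]) (auto intro: bounded_linear_inner_right)
  have "grad_in V \<phi> x = g" by (rule grad_in_eqI[OF V x gV g'])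
  with gV g' show "grad_in V \<phi> x \<in> V" 
    "(\<phi> has_derivative (\<lambda>v. grad_in V \<phi> x \<bullet> v)) (at x within V)" by auto
qed

text \<open>
  The bridge between the partial gradients, in which the algorithm is formulated, and the total
  derivative, which the mean value theorem and the subdifferential need.
\<close>

lemma partial_grad_eq_blockpart:
  assumes "(f has_derivative (\<lambda>v. g \<bullet> v)) (at z)"
  shows "partial_grad b f i z = blockpart b i g"
  unfolding partial_grad_def
proof (rule grad_in_eqI[OF subspace_blockspace])
  let ?V = "blockspace b i" and ?x = "blockpart b i z"
  have 1: "((\<lambda>w. z - ?x + w) has_derivative (\<lambda>v. v)) (at ?x within ?V)"
    by (auto intro!: derivative_eq_intros)
  have "(f has_derivative (\<lambda>v. g \<bullet> v)) (at (z - ?x + ?x) within (\<lambda>w. z - ?x + w) ` ?V)"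
    using assms by (simp add: has_derivative_at_withinI)
  from has_derivative_in_compose[OF 1 this]
  have 2: "((\<lambda>w. f (z - ?x + w)) has_derivative (\<lambda>v. g \<bullet> v)) (at ?x within ?V)" by simp
  show "((\<lambda>w. f (z - ?x + w)) has_derivative (\<lambda>v. blockpart b i g \<bullet> v)) (at ?x within ?V)"
  proof (rule has_derivative_within_subspace_cong[OF subspace_blockspace _ 2])
    fix v assume "v \<in> ?V"
    then show "blockpart b i g \<bullet> v = g \<bullet> v"
      by (metis blockpart_inner blockpart_same inner_commute)
  qed (auto intro: bounded_linear_inner_right)
qed auto

lemma mean_value_gradient:
  fixes f :: "'a::real_inner \<Rightarrow> real"
  assumes f: "\<And>x. (f has_derivative (\<lambda>v. g x \<bullet> v)) (at x)"
  obtains t where "0 < t" "t < 1" "f (u + d) - f u = g (u + t *\<^sub>R d) \<bullet> d"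
proof -
  have "((\<lambda>t. f (u + t *\<^sub>R d)) has_real_derivative g (u + t *\<^sub>R d) \<bullet> d) (at t)" for t
  proof -
    have "((\<lambda>t::real. u + t *\<^sub>R d) has_derivative (\<lambda>s. s *\<^sub>R d)) (at t)"
      by (auto intro!: derivative_eq_intros)
    from has_derivative_compose[OF this f] show ?thesis
      by (simp add: has_field_derivative_def mult.commute[of _ "g (u + t *\<^sub>R d) \<bullet> d"])
  qed
  then obtain t where "0 < t" "t < 1"
      "f (u + 1 *\<^sub>R d) - f (u + 0 *\<^sub>R d) = (1 - 0) * (g (u + t *\<^sub>R d) \<bullet> d)"
    using MVT2[of 0 "1::real" "\<lambda>t. f (u + t *\<^sub>R d)" "\<lambda>t. g (u + t *\<^sub>R d) \<bullet> d"] by auto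
  then show thesis using that by simp
qed

lemma convex_above_tangent:
  fixes \<phi> :: "'a::euclidean_space \<Rightarrow> real"
  assumes V: "subspace V" and x: "x \<in> V" and y: "y \<in> V" and conv: "convex_on V \<phi>"
    and d: "\<phi> differentiable (at x within V)"
  shows "\<phi> x + grad_in V \<phi> x \<bullet> (y - x) \<le> \<phi> y"
proof -
  have v: "y - x \<in> V" using V x y by (simp add: subspace_diff)
  have "((\<lambda>t::real. \<phi> (x + t *\<^sub>R (y - x))) has_derivative
      (\<lambda>t. grad_in V \<phi> x \<bullet> (t *\<^sub>R (y - x)))) (at 0)"
    by (rule has_derivative_along_line[OF V x v grad_in_props(2)[OF V x d]])
  then have der: "((\<lambda>t::real. \<phi> (x + t *\<^sub>R (y - x))) has_field_derivative
      (grad_in V \<phi> x \<bullet> (y - x))) (at 0 within UNIV)"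
    by (simp add: has_field_derivative_def mult.commute[of _ "grad_in V \<phi> x \<bullet> (y - x)"])
  have cv: "convex_on UNIV (\<lambda>t::real. \<phi> (x + t *\<^sub>R (y - x)))"
  proof (rule convex_onI)
    fix t s u :: real assume t: "0 < t" "t < 1"
    have "x + ((1 - t) *\<^sub>R s + t *\<^sub>R u) *\<^sub>R (y - x)
        = (1 - t) *\<^sub>R (x + s *\<^sub>R (y - x)) + t *\<^sub>R (x + u *\<^sub>R (y - x))"
      by (simp add: algebra_simps)
    moreover have "x + r *\<^sub>R (y - x) \<in> V" for r
      using V x v by (intro subspace_add subspace_scale)
    ultimately show "\<phi> (x + ((1 - t) *\<^sub>R s + t *\<^sub>R u) *\<^sub>R (y - x))
        \<le> (1 - t) * \<phi> (x + s *\<^sub>R (y - x)) + t * \<phi> (x + u *\<^sub>R (y - x))"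
      using convex_onD[OF conv, of t "x + s *\<^sub>R (y - x)" "x + u *\<^sub>R (y - x)"] t by simp
  qed auto
  from convex_on_imp_above_tangent[OF cv _ _ _ der, of 1] show ?thesis by simp
qed

section \<open>Convex constraints and inexact projections\<close>

text \<open>
  A local error bound for convex constraints is automatically global.  Move from \<open>x\<close> towards its
  nearest feasible point \<open>q\<close> until the distance to \<open>S\<close> is \<open>e\<close>.  The distance shrinks by the
  factor \<open>t\<close> exactly, because \<open>q\<close> remains the nearest point; by convexity and feasibility of
  \<open>q\<close> each constraint violation shrinks at least by \<open>t\<close>.  So the bound at the point reached
  carries over to \<open>x\<close> with the same constant.
\<close>

lemma error_bound_extends:
  fixes V :: "'a::euclidean_space set" and g :: "'j \<Rightarrow> 'a \<Rightarrow> real"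
  assumes V: "subspace V" and S: "S = {w \<in> V. \<forall>j\<in>J. g j w \<le> 0}"
    and ne: "S \<noteq> {}" and cl: "closed S"
    and conv: "\<And>j. j \<in> J \<Longrightarrow> convex_on V (g j)"
    and e: "0 < e" and c: "0 \<le> c"
    and bound: "\<And>x. x \<in> V \<Longrightarrow> infdist x S \<le> e \<Longrightarrow> infdist x S \<le> c * L2_set (\<lambda>j. max (g j x) 0) J"
    and x: "x \<in> V"
  shows "infdist x S \<le> c * L2_set (\<lambda>j. max (g j x) 0) J"
proof (cases "infdist x S \<le> e")
  case True
  then show ?thesis using bound x by simp
next
  case False
  define d where "d = infdist x S"
  have d: "e < d" "0 < d" using False e by (auto simp: d_def)
  obtain q where q: "q \<in> S" and dq: "dist x q = d"
    using infdist_attains_inf[OF cl ne] unfolding d_def by metis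
  define t where "t = e / d"
  have t: "0 < t" "t < 1" using d e by (auto simp: t_def)
  define y where "y = (1 - t) *\<^sub>R q + t *\<^sub>R x"
  have qV: "q \<in> V" using q S by simp
  have yV: "y \<in> V" unfolding y_def using V qV x by (simp add: subspace_add subspace_scale)
  have "dist y q = t * d"
  proof -
    have "y - q = t *\<^sub>R (x - q)" by (simp add: y_def algebra_simps)
    then show ?thesis using dq t by (simp add: dist_norm)
  qed
  then have ye: "infdist y S \<le> e"
    using infdist_le[OF q, of y] d by (simp add: t_def)
  have "dist x y = (1 - t) * d"
  proof -
    have "x - y = (1 - t) *\<^sub>R (x - q)" by (simp add: y_def algebra_simps)
    then show ?thesis using dq t by (simp add: dist_norm)
  qed
  then have "e \<le> infdist y S"
    using infdist_triangle[of x S y] d by (simp add: d_def[symmetric] t_def algebra_simps)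
  also have "\<dots> \<le> c * L2_set (\<lambda>j. max (g j y) 0) J" by (rule bound[OF yV ye])
  finally have ey: "e \<le> c * L2_set (\<lambda>j. max (g j y) 0) J" .
  have "L2_set (\<lambda>j. max (g j y) 0) J \<le> L2_set (\<lambda>j. t * max (g j x) 0) J"
  proof (rule L2_set_mono)
    fix j assume j: "j \<in> J"
    have "g j y \<le> (1 - t) * g j q + t * g j x"
      unfolding y_def using convex_onD[OF conv[OF j], of t q x] t qV x by simp
    also have "(1 - t) * g j q \<le> 0" using q S j t by (simp add: mult_nonneg_nonpos)
    also have "t * g j x \<le> t * max (g j x) 0" using t by simp
    finally show "max (g j y) 0 \<le> t * max (g j x) 0" using t by simp
  qed simp
  also have "L2_set (\<lambda>j. t * max (g j x) 0) J = t * L2_set (\<lambda>j. max (g j x) 0) J"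
    using t by (simp add: L2_set_right_distrib)
  finally have "c * L2_set (\<lambda>j. max (g j y) 0) J \<le> c * (t * L2_set (\<lambda>j. max (g j x) 0) J)"
    using c by (rule mult_left_mono)
  moreover have "e = t * d" using d by (simp add: t_def)
  ultimately have "t * d \<le> t * (c * L2_set (\<lambda>j. max (g j x) 0) J)"
    using ey by (simp add: mult.left_commute)
  then show ?thesis using t by (simp add: d_def)
qed

lemma residual_parts:
  assumes r: "residual b p h i x lam xt \<le> r" and p: "0 < p i"
    and w: "w = x - xt + (\<Sum>j\<in>{1..p i}. lam j *\<^sub>R grad_in (blockspace b i) (h i j) x)"
  shows "x \<bullet> w \<le> r" "infnorm w \<le> r" "\<And>j. j \<in> {1..p i} \<Longrightarrow> max (h i j x) 0 \<le> r"
    "- (\<Sum>j\<in>{1..p i}. lam j * h i j x) \<le> r"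
proof -
  let ?m = "Max ((\<lambda>j. \<bar>max (h i j x) 0\<bar>) ` {1..p i})"
  have le: "max (x \<bullet> w) 0 + infnorm w + ?m + max (- (\<Sum>j\<in>{1..p i}. lam j * h i j x)) 0 \<le> r"
    using r by (simp add: residual_def Let_def w)
  have m: "max (h i j x) 0 \<le> ?m" if "j \<in> {1..p i}" for j
    by (rule order_trans[OF abs_ge_self Max_ge]) (use that in auto)
  have m0: "0 \<le> ?m" using m[of 1] p by auto
  have n0: "0 \<le> infnorm w" by (rule infnorm_pos_le)
  show "x \<bullet> w \<le> r" "infnorm w \<le> r" "- (\<Sum>j\<in>{1..p i}. lam j * h i j x) \<le> r"
    using le m0 n0 by linarith+
  show "max (h i j x) 0 \<le> r" if "j \<in> {1..p i}" for j
    using le m0 n0 m[OF that] by linarith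
qed

text \<open>
  How far an approximate KKT point \<open>x\<close> of the projection problem is from the true projection
  \<open>y\<close> of \<open>xt\<close>.  Split \<open>norm (x - y)\<^sup>2\<close> into \<open>(x - y) \<bullet> (x - xt)\<close> and \<open>(xt - y) \<bullet> (x - y)\<close>.  In the
  first part, \<open>x - xt\<close> is the stationarity defect minus the weighted constraint gradients, and
  convexity replaces the gradients by constraint values, so that only terms of the
  residual remain.  In the second part \<open>x\<close> can be exchanged for its nearest feasible point \<open>q\<close> at
  the cost of the infeasibility of \<open>x\<close>, and the variational inequality at \<open>y\<close> gives the right
  sign for \<open>q\<close>.  The square of the distance is linear in the residual, whence the square root in
  the stopping rule of the algorithm.
\<close>

lemma inexact_projection:
  fixes x xt y :: "real ^ 'd::finite"
  assumes x: "x \<in> blockspace b i" and lam: "\<forall>j\<in>{1..p i}. 0 \<le> lam j"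
    and r: "residual b p h i x lam xt \<le> r" and p: "0 < p i"
    and h_convex: "\<And>j. j \<in> {1..p i} \<Longrightarrow> convex_on (blockspace b i) (h i j)"
    and h_diff: "\<And>j. j \<in> {1..p i} \<Longrightarrow> h i j differentiable_on blockspace b i"
    and S: "convex (feas b p h i)" "closed (feas b p h i)"
    and y: "y \<in> feas b p h i" and closest: "\<forall>u\<in>feas b p h i. dist xt y \<le> dist xt u"
    and infd: "infdist x (feas b p h i) \<le> c * r"
    and R: "norm y \<le> R" and D: "dist xt y \<le> D"
  shows "(norm (x - y))\<^sup>2 \<le> (R * sqrt (real (DIM(real ^ 'd))) + 2 + D * c) * r"
proof -
  let ?V = "blockspace b i" and ?S = "feas b p h i" and ?J = "{1..p i}"
  let ?g = "\<lambda>j. grad_in ?V (h i j) x" and ?N = "sqrt (real (DIM(real ^ 'd)))"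
  define w where "w = x - xt + (\<Sum>j\<in>?J. lam j *\<^sub>R ?g j)"
  note parts = residual_parts[OF r p w_def]
  have yV: "y \<in> ?V" and hy: "\<And>j. j \<in> ?J \<Longrightarrow> h i j y \<le> 0" using y by (auto simp: feas_def)
  have nw: "norm w \<le> ?N * r"
    by (rule order_trans[OF norm_le_infnorm mult_left_mono[OF parts(2)]]) simp
  have "- (y \<bullet> w) \<le> norm y * norm w" using norm_cauchy_schwarz[of "-y" w] by simp
  also have "\<dots> \<le> R * (?N * r)" using R nw norm_ge_zero[of y] norm_ge_zero[of w] by (intro mult_mono) linarith+
  finally have yw: "- (y \<bullet> w) \<le> R * (?N * r)" .
  have "(\<Sum>j\<in>?J. lam j * (?g j \<bullet> (y - x))) \<le> (\<Sum>j\<in>?J. - (lam j * h i j x))"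
  proof (rule sum_mono)
    fix j assume j: "j \<in> ?J"
    have "h i j x + ?g j \<bullet> (y - x) \<le> h i j y"
      using h_diff[OF j] x
      by (intro convex_above_tangent[OF subspace_blockspace x yV h_convex[OF j]])
        (auto simp: differentiable_on_def)
    then have "?g j \<bullet> (y - x) \<le> - h i j x" using hy[OF j] by linarith
    then have "lam j * (?g j \<bullet> (y - x)) \<le> lam j * (- h i j x)"
      using lam j by (intro mult_left_mono) auto
    then show "lam j * (?g j \<bullet> (y - x)) \<le> - (lam j * h i j x)" by simp
  qed
  also have "\<dots> \<le> r" using parts(4) by (simp add: sum_negf)
  finally have g: "(\<Sum>j\<in>?J. lam j *\<^sub>R ?g j) \<bullet> (y - x) \<le> r"
    by (simp add: inner_sum_left)
  have "(x - y) \<bullet> (x - xt) = x \<bullet> w - y \<bullet> w + (\<Sum>j\<in>?J. lam j *\<^sub>R ?g j) \<bullet> (y - x)"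
    by (simp add: w_def algebra_simps inner_commute)
  then have 1: "(x - y) \<bullet> (x - xt) \<le> r + R * (?N * r) + r"
    using parts(1) yw g by linarith
  obtain q where q: "q \<in> ?S" and dq: "dist x q = infdist x ?S"
    using infdist_attains_inf[OF S(2)] y by (metis empty_iff)
  have "(xt - y) \<bullet> (q - y) \<le> 0"
    by (rule any_closest_point_dot[OF S y q closest])
  moreover have "(xt - y) \<bullet> (x - q) \<le> D * (c * r)"
  proof -
    have "(xt - y) \<bullet> (x - q) \<le> norm (xt - y) * norm (x - q)" by (rule norm_cauchy_schwarz)
    also have "\<dots> \<le> D * (c * r)"
      using D dq infd order_trans[OF zero_le_dist D]
      by (intro mult_mono) (auto simp: dist_norm infdist_nonneg)
    finally show ?thesis .
  qed
  moreover have "(norm (x - y))\<^sup>2 = (x - y) \<bullet> (x - xt) + (xt - y) \<bullet> (x - q) + (xt - y) \<bullet> (q - y)"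
    by (simp add: power2_norm_eq_inner algebra_simps inner_commute)
  ultimately show ?thesis using 1 by (simp add: algebra_simps)
qed

text \<open>
  Completing the square: the proximal linearised subproblem is a projection.
\<close>

lemma proximal_arg_min:
  fixes g u :: "'a::euclidean_space"
  assumes S: "compact S" "S \<noteq> {}" and \<sigma>: "0 < \<sigma>"
    and y: "y = arg_min (\<lambda>x. g \<bullet> (x - u) + \<sigma> / 2 * (norm (x - u))\<^sup>2) (\<lambda>x. x \<in> S)"
  shows "y \<in> S \<and> (\<forall>x\<in>S. dist (u - (1 / \<sigma>) *\<^sub>R g) y \<le> dist (u - (1 / \<sigma>) *\<^sub>R g) x)"
proof -
  let ?Q = "\<lambda>x. g \<bullet> (x - u) + \<sigma> / 2 * (norm (x - u))\<^sup>2"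
  have "continuous_on S ?Q" by (intro continuous_intros)
  then obtain a where "a \<in> S" "\<forall>x\<in>S. ?Q a \<le> ?Q x"
    using continuous_attains_inf[OF S] by blast
  then have "is_arg_min ?Q (\<lambda>x. x \<in> S) a" by (force simp: is_arg_min_def)
  then have "is_arg_min ?Q (\<lambda>x. x \<in> S) y" unfolding y arg_min_def by (rule someI)
  then have yS: "y \<in> S" and min: "\<And>x. x \<in> S \<Longrightarrow> ?Q y \<le> ?Q x"
    by (auto simp: is_arg_min_def not_less)
  have sq: "(dist (u - (1 / \<sigma>) *\<^sub>R g) x)\<^sup>2 = 2 / \<sigma> * ?Q x + (norm g / \<sigma>)\<^sup>2" for x
  proof -
    have "dist (u - (1 / \<sigma>) *\<^sub>R g) x = norm ((x - u) + (1 / \<sigma>) *\<^sub>R g)"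
      by (subst dist_commute) (simp add: dist_norm algebra_simps)
    moreover have "(norm (v + s *\<^sub>R g))\<^sup>2 = (norm v)\<^sup>2 + 2 * s * (g \<bullet> v) + s\<^sup>2 * (norm g)\<^sup>2" for v s
      unfolding power2_norm_eq_inner
      by (simp add: inner_add_left inner_add_right inner_commute[of v g] power2_eq_square distrib_left)
    ultimately show ?thesis using \<sigma> by (simp add: distrib_left power_divide)
  qed
  have "dist (u - (1 / \<sigma>) *\<^sub>R g) y \<le> dist (u - (1 / \<sigma>) *\<^sub>R g) x" if "x \<in> S" for x
  proof (rule power2_le_imp_le)
    show "(dist (u - (1 / \<sigma>) *\<^sub>R g) y)\<^sup>2 \<le> (dist (u - (1 / \<sigma>) *\<^sub>R g) x)\<^sup>2"
      unfolding sq using min[OF that] \<sigma> by (intro add_right_mono mult_left_mono) auto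
  qed simp
  then show ?thesis using yS S by blast
qed

section \<open>Subgradients of a constrained function\<close>

lemma objF_eq:
  "objF b n p f h x = (if x \<in> blockprod b n (feas b p h) then ereal (f x) else \<infinity>)"
proof (cases "x \<in> blockprod b n (feas b p h)")
  case True
  then show ?thesis by (simp add: objF_def blockprod_def delta_def)
next
  case False
  then obtain i where "i \<in> {1..n}" "delta (feas b p h i) (blockpart b i x) = \<infinity>"
    by (auto simp: blockprod_def delta_def)
  then have "(\<Sum>i\<in>{1..n}. delta (feas b p h i) (blockpart b i x)) = \<infinity>"
    unfolding sum_Pinfty by blast
  with False show ?thesis by (simp add: objF_def)
qed

text \<open>
  A gradient plus a normal vector is a subgradient: off \<open>S\<close> the difference quotients are infinite,
  and on \<open>S\<close> the normal vector can only increase them.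
\<close>

lemma frechet_subdiff_normal:
  fixes f :: "'a::euclidean_space \<Rightarrow> real"
  assumes G: "\<And>y. G y = (if y \<in> S then ereal (f y) else \<infinity>)" and x: "x \<in> S"
    and f: "(f has_derivative (\<lambda>v. g \<bullet> v)) (at x)"
    and \<nu>: "\<And>y. y \<in> S \<Longrightarrow> \<nu> \<bullet> (y - x) \<le> 0"
  shows "g + \<nu> \<in> frechet_subdiff G x"
proof -
  let ?q = "\<lambda>y. (G y - G x - ereal ((g + \<nu>) \<bullet> (y - x))) / ereal (norm (y - x))"
  have "\<forall>\<^sub>F y in at x. C < ?q y" if C: "C < 0" for C
  proof -
    obtain e where e: "0 < e" "C < ereal (- e)"
    proof (cases C)
      case (real r)
      then show ?thesis using C that[of "- r / 2"] by auto
    next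
      case MInf
      then show ?thesis using that[of 1] by simp
    qed (use C in auto)
    have "((\<lambda>y. (f y - f x - g \<bullet> (y - x)) / norm (y - x)) \<longlongrightarrow> 0) (at x)"
      using f by (simp add: has_derivative_within diff_diff_eq)
    then have "\<forall>\<^sub>F y in at x. - e < (f y - f x - g \<bullet> (y - x)) / norm (y - x)"
      by (rule order_tendstoD) (use e in simp)
    moreover have "\<forall>\<^sub>F y in at x. y \<noteq> x" by (simp add: eventually_at_filter)
    ultimately show ?thesis
    proof eventually_elim
      case (elim y)
      then have n: "0 < norm (y - x)" by simp
      show ?case
      proof (cases "y \<in> S")
        case True
        have "- e < (f y - f x - g \<bullet> (y - x)) / norm (y - x)"
          by (rule elim(1))
        also have "\<dots> \<le> (f y - f x - (g + \<nu>) \<bullet> (y - x)) / norm (y - x)"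
          using \<nu>[OF True] n by (intro divide_right_mono) (auto simp: inner_add_left)
        finally have "ereal (- e) < ?q y" using G x True n by simp
        then show ?thesis using e by (meson less_trans)
      next
        case False
        then have "?q y = \<infinity>" using G x n by simp
        then show ?thesis using C by auto
      qed
    qed
  qed
  then have "0 \<le> Liminf (at x) ?q" by (auto simp: le_Liminf_iff)
  then show ?thesis using G x by (simp add: frechet_subdiff_def)
qed

section \<open>Rates for sequences with perturbed decrease\<close>

text \<open>
  A subsequence that keeps its distance from \<open>l\<close> would have a second limit point by compactness.
\<close>

lemma bounded_unique_limit_point:
  fixes X :: "nat \<Rightarrow> 'a::heine_borel"
  assumes bnd: "bounded (range X)" and uniq: "\<And>w. seq_limit_point X w \<Longrightarrow> w = l"
  shows "X \<longlonglongrightarrow> l"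
proof (rule ccontr)
  assume "\<not> X \<longlonglongrightarrow> l"
  then obtain e where e: "0 < e" "\<exists>\<^sub>F k in sequentially. e \<le> dist (X k) l"
    unfolding tendsto_iff frequently_def by (auto simp: not_le)
  then have "infinite {k. e \<le> dist (X k) l}"
    by (simp add: frequently_cofinite[symmetric] cofinite_eq_sequentially)
  then obtain r :: "nat \<Rightarrow> nat" where r: "strict_mono r" "\<And>k. e \<le> dist (X (r k)) l"
    using infinite_enumerate by blast
  have "bounded (range (X \<circ> r))" using bnd by (rule bounded_subset) auto
  then obtain w s where s: "strict_mono s" "((X \<circ> r) \<circ> s) \<longlonglongrightarrow> w"
    using bounded_imp_convergent_subsequence by blast
  have "strict_mono (r \<circ> s)" using r s by (simp add: strict_mono_o)
  then have "seq_limit_point X w" unfolding seq_limit_point_def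
    using s by (metis comp_assoc)
  then have "((X \<circ> r) \<circ> s) \<longlonglongrightarrow> l" using uniq s by blast
  then have "(\<lambda>k. dist (X (r (s k))) l) \<longlonglongrightarrow> 0"
    unfolding o_def by (rule tendsto_dist_iff[THEN iffD1])
  then have "e \<le> 0" by (rule LIMSEQ_le_const) (use r in auto)
  with e show False by simp
qed

lemma powr_neg_step:
  fixes x \<beta> :: real
  assumes x: "0 < x" and \<beta>: "0 < \<beta>"
  shows "x powr - \<beta> - (x + 1) powr - \<beta> \<le> \<beta> * x powr - (\<beta> + 1)"
    and "\<beta> * (x + 1) powr - (\<beta> + 1) \<le> x powr - \<beta> - (x + 1) powr - \<beta>"
proof -
  have "((\<lambda>t. t powr - \<beta>) has_real_derivative - \<beta> * t powr (- \<beta> - 1)) (at t)" if "x \<le> t" for t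
    using x that by (auto intro!: derivative_eq_intros simp: field_simps powr_diff)
  then obtain t where t: "x < t" "t < x + 1"
      and eq: "(x + 1) powr - \<beta> - x powr - \<beta> = (x + 1 - x) * (- \<beta> * t powr (- \<beta> - 1))"
    using MVT2[of x "x + 1" "\<lambda>t. t powr - \<beta>" "\<lambda>t. - \<beta> * t powr (- \<beta> - 1)"] by auto
  have "t powr (- \<beta> - 1) \<le> x powr (- \<beta> - 1)" "(x + 1) powr (- \<beta> - 1) \<le> t powr (- \<beta> - 1)"
    using x t \<beta> by (auto intro!: powr_mono2')
  then have "\<beta> * t powr (- \<beta> - 1) \<le> \<beta> * x powr (- \<beta> - 1)"
      "\<beta> * (x + 1) powr (- \<beta> - 1) \<le> \<beta> * t powr (- \<beta> - 1)"
    using \<beta> by auto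
  moreover have "- (\<beta> + 1) = - \<beta> - 1" by simp
  ultimately show "x powr - \<beta> - (x + 1) powr - \<beta> \<le> \<beta> * x powr - (\<beta> + 1)"
    "\<beta> * (x + 1) powr - (\<beta> + 1) \<le> x powr - \<beta> - (x + 1) powr - \<beta>"
    using eq by (simp_all only:) (auto simp: algebra_simps)
qed

lemma powr_neg_half:
  fixes \<beta> :: real
  assumes "1 \<le> k" "0 \<le> \<beta>"
  shows "real k powr - \<beta> \<le> 2 powr \<beta> * real (Suc k) powr - \<beta>"
proof -
  have "real k powr - \<beta> \<le> (real (Suc k) / 2) powr - \<beta>"
    using assms by (intro powr_mono2') auto
  also have "\<dots> = 2 powr \<beta> * real (Suc k) powr - \<beta>"
    by (subst powr_divide) (auto simp: powr_minus field_simps)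
  finally show ?thesis .
qed

text \<open>
  A discrete version of \<open>a' \<le> - a powr (1 + 1 / \<beta>)\<close>, whose solutions decay like \<open>k powr - \<beta>\<close>; the
  perturbation is of the size of the derivative of that comparison function.  The induction
  step works for every \<open>C\<close> with \<open>C powr (1 + 1 / \<beta>) \<ge> c * (C * B) + c\<close>, where the drop of
  \<open>k powr - \<beta>\<close> in one step is at most \<open>B * Suc k powr - (\<beta> + 1)\<close>; since the exponent exceeds 1, all large \<open>C\<close> qualify.
\<close>

lemma nonlinear_recursion_rate:
  fixes a :: "nat \<Rightarrow> real"
  assumes \<beta>: "0 < \<beta>" and c: "0 < c" and K: "1 \<le> K"
    and pos: "\<And>k. K \<le> k \<Longrightarrow> 0 \<le> a k"
    and rec: "\<And>k. K \<le> k \<Longrightarrow>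
      a (Suc k) powr (1 + 1 / \<beta>) \<le> c * (a k - a (Suc k)) + c * real (Suc k) powr - (\<beta> + 1)"
  obtains C where "0 \<le> C" "\<And>k. K \<le> k \<Longrightarrow> a k \<le> C * real k powr - \<beta>"
proof -
  define B where "B = \<beta> * 2 powr (\<beta> + 1)"
  define C where "C = max 1 (max (a K * real K powr \<beta>) ((c * (B + 1)) powr \<beta>))"
  have B: "0 < B" using \<beta> by (simp add: B_def)
  have C1: "1 \<le> C" and CK: "a K * real K powr \<beta> \<le> C" and C2: "(c * (B + 1)) powr \<beta> \<le> C"
    by (auto simp: C_def)
  have "c * (B + 1) = ((c * (B + 1)) powr \<beta>) powr (1 / \<beta>)"
    using \<beta> c B by (simp add: powr_powr)
  also have "\<dots> \<le> C powr (1 / \<beta>)" using C2 \<beta> by (intro powr_mono2) auto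
  finally have C3: "c * (B + 1) \<le> C powr (1 / \<beta>)" .
  have "c * (C * B) + c \<le> C * (c * (B + 1))"
    using C1 c mult_left_mono[OF C1, of c] by (simp add: algebra_simps)
  also have "\<dots> \<le> C * C powr (1 / \<beta>)" using C3 C1 by (intro mult_left_mono) auto
  also have "\<dots> = C powr (1 + 1 / \<beta>)" using C1 by (simp add: powr_add)
  finally have C4: "c * (C * B) + c \<le> C powr (1 + 1 / \<beta>)" .
  have "a k \<le> C * real k powr - \<beta>" if "K \<le> k" for k
    using that
  proof (induction k rule: dec_induct)
    case base
    have "a K = (a K * real K powr \<beta>) * real K powr - \<beta>"
      using K by (simp add: powr_minus field_simps)
    also have "\<dots> \<le> C * real K powr - \<beta>" using CK by (intro mult_right_mono) auto
    finally show ?case .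
  next
    case (step k)
    let ?x = "real (Suc k)"
    show ?case
    proof (rule ccontr)
      assume "\<not> a (Suc k) \<le> C * ?x powr - \<beta>"
      then have less: "C * ?x powr - \<beta> < a (Suc k)" by simp
      have "- \<beta> * (1 + 1 / \<beta>) = - (\<beta> + 1)" using \<beta> by (simp add: field_simps)
      then have "C powr (1 + 1 / \<beta>) * ?x powr - (\<beta> + 1) = (C * ?x powr - \<beta>) powr (1 + 1 / \<beta>)"
        using C1 by (simp add: powr_mult powr_powr)
      also have "\<dots> \<le> a (Suc k) powr (1 + 1 / \<beta>)"
        using less C1 \<beta> by (intro powr_mono2) auto
      also have "\<dots> \<le> c * (a k - a (Suc k)) + c * ?x powr - (\<beta> + 1)"
        using rec step by simp
      finally have *: "C powr (1 + 1 / \<beta>) * ?x powr - (\<beta> + 1)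
          \<le> c * (a k - a (Suc k)) + c * ?x powr - (\<beta> + 1)" .
      have "(c * (C * B) + c) * ?x powr - (\<beta> + 1) \<le> C powr (1 + 1 / \<beta>) * ?x powr - (\<beta> + 1)"
        using C4 by (intro mult_right_mono) auto
      with * have "c * (C * B * ?x powr - (\<beta> + 1)) \<le> c * (a k - a (Suc k))"
        by (simp add: algebra_simps)
      then have drop: "C * B * ?x powr - (\<beta> + 1) \<le> a k - a (Suc k)" using c by simp
      have k: "0 < real k" using step K by simp
      have "real k powr - \<beta> - ?x powr - \<beta> \<le> \<beta> * real k powr - (\<beta> + 1)"
        using powr_neg_step(1)[OF k \<beta>] by (simp add: add.commute)
      also have "\<dots> \<le> \<beta> * (2 powr (\<beta> + 1) * ?x powr - (\<beta> + 1))"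
        using \<beta> step K by (intro mult_left_mono powr_neg_half) auto
      finally have "C * (real k powr - \<beta> - ?x powr - \<beta>) \<le> C * (B * ?x powr - (\<beta> + 1))"
        using C1 by (intro mult_left_mono) (auto simp: B_def)
      with drop step.IH less show False by (simp add: algebra_simps)
    qed
  qed
  then show thesis using that[of C] C1 by simp
qed

text \<open>
  Summing the steps along \<open>k, 2 k, 4 k, \<dots>\<close> gives a geometric series with ratio \<open>2 powr - \<rho>\<close>.
\<close>

lemma dyadic_rate:
  fixes y :: "nat \<Rightarrow> 'a::real_normed_vector"
  assumes \<rho>: "0 < \<rho>" and K: "1 \<le> K" and lim: "y \<longlonglongrightarrow> w"
    and step: "\<And>k. K \<le> k \<Longrightarrow> norm (y (2 * k) - y k) \<le> C * real k powr - \<rho>"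
    and k: "K \<le> k"
  shows "norm (w - y k) \<le> C / (1 - 2 powr - \<rho>) * real k powr - \<rho>"
proof -
  define q where "q = (2::real) powr - \<rho>"
  have q: "0 < q" "q < 1" using \<rho> powr_less_mono[of "-\<rho>" 0 2] by (auto simp: q_def)
  define B where "B = C / (1 - q)"
  have B: "B * (1 - q) = C" using q by (simp add: B_def)
  let ?x = "real k powr - \<rho>"
  have "0 \<le> C * ?x" using step[OF k] norm_ge_zero order_trans by blast
  then have B0: "0 \<le> B * ?x" using q by (simp add: B_def zero_le_divide_iff zero_le_mult_iff)
  have bound: "norm (y (2 ^ j * k) - y k) \<le> B * (1 - q ^ j) * ?x" for j
  proof (induction j)
    case (Suc j)
    have "norm (y (2 * (2 ^ j * k)) - y (2 ^ j * k)) \<le> C * real (2 ^ j * k) powr - \<rho>"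
      using k by (intro step) (simp add: trans_le_add2 order_trans[OF k])
    also have "real (2 ^ j * k) powr - \<rho> = q ^ j * ?x"
      by (simp add: powr_mult q_def powr_power powr_realpow[symmetric] powr_powr mult.commute)
    finally have "norm (y (2 * (2 ^ j * k)) - y (2 ^ j * k)) \<le> B * (1 - q) * (q ^ j * ?x)"
      by (simp add: B)
    with Suc norm_triangle_ineq[of "y (2 * (2 ^ j * k)) - y (2 ^ j * k)" "y (2 ^ j * k) - y k"]
    show ?case by (simp add: algebra_simps)
  qed simp
  have "norm (y (2 ^ j * k) - y k) \<le> B * ?x" for j
  proof -
    have "B * ?x * (1 - q ^ j) \<le> B * ?x"
      using B0 q by (intro mult_left_le) auto
    with bound[of j] show ?thesis by (simp add: mult.commute mult.left_commute)
  qed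
  moreover have "(\<lambda>j. norm (y (2 ^ j * k) - y k)) \<longlonglongrightarrow> norm (w - y k)"
  proof -
    have "strict_mono (\<lambda>j. 2 ^ j * k)" using k K by (auto simp: strict_mono_Suc_iff)
    from LIMSEQ_subseq_LIMSEQ[OF lim this] show ?thesis
      by (intro tendsto_intros) (simp add: o_def)
  qed
  ultimately show ?thesis
    unfolding q_def[symmetric] B_def[symmetric] by (intro LIMSEQ_le_const2) auto
qed

text \<open>
  Cauchy-Schwarz over the \<open>k\<close> steps from \<open>k\<close> to \<open>2 k\<close>, whose squares add up to at most
  \<open>a k / \<kappa>\<close>.  So the decay of \<open>a\<close> alone controls the length of the path.
\<close>

lemma dyadic_step_of_decrease:
  fixes y :: "nat \<Rightarrow> 'a::real_normed_vector"
  assumes \<kappa>: "0 < \<kappa>"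
    and pos: "\<And>k. K \<le> k \<Longrightarrow> 0 \<le> a k"
    and dec: "\<And>k. K \<le> k \<Longrightarrow> a (Suc k) + \<kappa> * (norm (y (Suc k) - y k))\<^sup>2 \<le> a k"
    and k: "K \<le> k"
  shows "norm (y (2 * k) - y k) \<le> sqrt (real k * a k / \<kappa>)"
proof -
  let ?s = "\<lambda>t. norm (y (Suc (k + t)) - y (k + t))"
  have tel: "norm (y (k + N) - y k) \<le> (\<Sum>t<N. ?s t)"
    and sq: "a (k + N) + \<kappa> * (\<Sum>t<N. (?s t)\<^sup>2) \<le> a k" for N
  proof (induction N)
    case (Suc N)
    show "norm (y (k + Suc N) - y k) \<le> (\<Sum>t<Suc N. ?s t)"
      using Suc(1) norm_triangle_ineq[of "y (Suc (k + N)) - y (k + N)" "y (k + N) - y k"] by simp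
    show "a (k + Suc N) + \<kappa> * (\<Sum>t<Suc N. (?s t)\<^sup>2) \<le> a k"
      using Suc(2) dec[of "k + N"] k by (simp add: distrib_left)
  qed auto
  have "(\<Sum>t<k. ?s t)\<^sup>2 \<le> (\<Sum>t<k. (?s t)\<^sup>2) * real k"
    using sum_squared_le_sum_of_squares[of ?s "{..<k}"] by simp
  also have "\<dots> \<le> (a k / \<kappa>) * real k"
  proof (intro mult_right_mono)
    show "(\<Sum>t<k. (?s t)\<^sup>2) \<le> a k / \<kappa>"
      using sq[of k] pos[of "k + k"] k \<kappa> by (simp add: field_simps)
  qed simp
  finally have "(\<Sum>t<k. ?s t) \<le> sqrt (real k * a k / \<kappa>)"
    by (intro real_le_rsqrt) (simp add: mult.commute)
  with tel[of k] show ?thesis by (simp add: mult_2)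
qed

text \<open>
  Squaring the inequality for \<open>a (Suc k) powr \<Theta>\<close> and inserting the decrease condition leads to
  the recursion of \<open>nonlinear_recursion_rate\<close> with \<open>\<beta> = 1 / (2 * \<Theta> - 1)\<close>.  The perturbation exponent
  \<open>\<Theta> / (2 * \<Theta> - 1) = (\<beta> + 1) / 2\<close> is the critical one: the squared perturbation
  has the same order as the decrement of \<open>k powr - \<beta>\<close>, so the perturbation does not spoil the rate.  The dyadic
  steps are then of order \<open>sqrt (k * k powr - \<beta>) = k powr - \<rho>\<close>.
\<close>

lemma lojasiewicz_rate:
  fixes y :: "nat \<Rightarrow> 'a::real_normed_vector"
  assumes \<kappa>: "0 < \<kappa>" and c: "0 < c" and \<Theta>: "1 / 2 < \<Theta>" "\<Theta> < 1" and K: "1 \<le> K"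
    and lim: "y \<longlonglongrightarrow> w"
    and pos: "\<And>k. K \<le> k \<Longrightarrow> 0 \<le> a k"
    and dec: "\<And>k. K \<le> k \<Longrightarrow> a (Suc k) + \<kappa> * (norm (y (Suc k) - y k))\<^sup>2 \<le> a k"
    and loj: "\<And>k. K \<le> k \<Longrightarrow>
      a (Suc k) powr \<Theta> \<le> c * (norm (y (Suc k) - y k) + real (Suc k) powr - (\<Theta> / (2 * \<Theta> - 1)))"
  obtains C where "0 \<le> C"
    "\<And>k. K \<le> k \<Longrightarrow> norm (w - y k) \<le> C * real k powr - ((1 - \<Theta>) / (2 * \<Theta> - 1))"
proof -
  define \<beta> where "\<beta> = 1 / (2 * \<Theta> - 1)"
  define \<rho> where "\<rho> = (1 - \<Theta>) / (2 * \<Theta> - 1)"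
  have \<beta>: "0 < \<beta>" and \<rho>: "0 < \<rho>" using \<Theta> by (auto simp: \<beta>_def \<rho>_def)
  have e1: "\<Theta> * 2 = 1 + 1 / \<beta>" by (simp add: \<beta>_def)
  have e2: "- (\<Theta> / (2 * \<Theta> - 1)) * 2 = - (\<beta> + 1)" and e3: "(1 - \<beta>) / 2 = - \<rho>"
    using \<Theta> by (auto simp: \<beta>_def \<rho>_def field_simps)
  define T where "T = 1 + 1 / \<kappa>"
  define c' where "c' = 2 * c\<^sup>2 * T"
  have c': "0 < c'" using c \<kappa> by (simp add: c'_def T_def add_pos_pos)
  have rec: "a (Suc k) powr (1 + 1 / \<beta>) \<le> c' * (a k - a (Suc k)) + c' * real (Suc k) powr - (\<beta> + 1)"
    if k: "K \<le> k" for k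
  proof -
    let ?s = "norm (y (Suc k) - y k)" and ?e = "real (Suc k) powr - (\<Theta> / (2 * \<Theta> - 1))"
    have s: "?s\<^sup>2 \<le> (1 / \<kappa>) * (a k - a (Suc k))" using dec[OF k] \<kappa> by (simp add: field_simps)
    have d: "0 \<le> a k - a (Suc k)" using dec[OF k] \<kappa> by (smt (verit) mult_nonneg_nonneg zero_le_power2)
    have p2: "u powr (v * 2) = (u powr v)\<^sup>2" for u v :: real
      by (simp add: powr_powr[symmetric] powr_numeral)
    have "a (Suc k) powr (1 + 1 / \<beta>) = (a (Suc k) powr \<Theta>)\<^sup>2"
      unfolding e1[symmetric] p2 ..
    also have "\<dots> \<le> (c * (?s + ?e))\<^sup>2" using loj[OF k] by (intro power_mono) auto
    also have "\<dots> = c\<^sup>2 * (?s + ?e)\<^sup>2" by (simp add: power_mult_distrib)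
    also have "\<dots> \<le> c\<^sup>2 * (2 * ?s\<^sup>2 + 2 * ?e\<^sup>2)"
      by (intro mult_left_mono) (use sum_squares_ge_zero[of "?s - ?e" 0] in \<open>simp_all add: power2_eq_square algebra_simps\<close>)
    also have "?e\<^sup>2 = real (Suc k) powr - (\<beta> + 1)"
      unfolding e2[symmetric] p2 ..
    also have "c\<^sup>2 * (2 * ?s\<^sup>2 + 2 * real (Suc k) powr - (\<beta> + 1))
        \<le> c\<^sup>2 * (2 * (T * (a k - a (Suc k))) + 2 * (T * real (Suc k) powr - (\<beta> + 1)))"
    proof (intro mult_left_mono add_mono)
      show "?s\<^sup>2 \<le> T * (a k - a (Suc k))" using s d by (simp add: T_def distrib_right)
      show "real (Suc k) powr - (\<beta> + 1) \<le> T * real (Suc k) powr - (\<beta> + 1)"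
        using \<kappa> by (simp add: T_def distrib_right)
    qed auto
    finally show ?thesis by (simp add: c'_def algebra_simps)
  qed
  obtain C where C: "0 \<le> C" and aC: "\<And>k. K \<le> k \<Longrightarrow> a k \<le> C * real k powr - \<beta>"
    using nonlinear_recursion_rate[OF \<beta> c' K pos rec] by blast
  have "norm (y (2 * k) - y k) \<le> sqrt (C / \<kappa>) * real k powr - \<rho>" if k: "K \<le> k" for k
  proof -
    have "norm (y (2 * k) - y k) \<le> sqrt (real k * a k / \<kappa>)"
      by (rule dyadic_step_of_decrease[where a = a and y = y and K = K, OF \<kappa> pos dec k])
    also have "\<dots> \<le> sqrt (C / \<kappa> * real k powr (1 - \<beta>))"
    proof (rule real_sqrt_le_mono)
      have "real k * a k / \<kappa> \<le> real k * (C * real k powr - \<beta>) / \<kappa>"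
        using aC[OF k] \<kappa> by (intro divide_right_mono mult_left_mono) auto
      also have "\<dots> = C / \<kappa> * real k powr (1 - \<beta>)"
        using k K by (simp add: powr_diff powr_minus divide_inverse)
      finally show "real k * a k / \<kappa> \<le> C / \<kappa> * real k powr (1 - \<beta>)" .
    qed
    also have "\<dots> = sqrt (C / \<kappa>) * real k powr - \<rho>"
    proof -
      have "sqrt (real k powr (1 - \<beta>)) = real k powr ((1 - \<beta>) * (1 / 2))"
        by (simp only: powr_powr[symmetric] powr_half_sqrt powr_ge_zero)
      moreover have "(1 - \<beta>) * (1 / 2) = - \<rho>" using e3 by simp
      ultimately show ?thesis unfolding real_sqrt_mult by simp
    qed
    finally show ?thesis .
  qed
  from dyadic_rate[where K = K, OF \<rho> K lim this]
  have "norm (w - y k) \<le> sqrt (C / \<kappa>) / (1 - 2 powr - \<rho>) * real k powr - \<rho>" if "K \<le> k" for k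
    using that by blast
  moreover have "0 \<le> sqrt (C / \<kappa>) / (1 - 2 powr - \<rho>)"
    using C \<kappa> \<rho> powr_less_mono[of "-\<rho>" 0 2] by (intro divide_nonneg_nonneg) auto
  ultimately show thesis using that unfolding \<rho>_def by blast
qed

section \<open>The iterates stay close to the exact solutions\<close>

locale inexact_palm =
  fixes b :: "'d::finite \<Rightarrow> nat" and n :: nat and m p :: "nat \<Rightarrow> nat"
    and f :: "real ^ 'd \<Rightarrow> real" and h :: "nat \<Rightarrow> nat \<Rightarrow> real ^ 'd \<Rightarrow> real"
    and Lc :: "nat \<Rightarrow> real" and L \<gamma> M \<epsilon>bar l :: real
    and \<epsilon> :: "nat \<Rightarrow> real" and \<sigma> :: "nat \<Rightarrow> nat \<Rightarrow> real"
    and z zb :: "nat \<Rightarrow> real ^ 'd" and zb0 :: "real ^ 'd"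
  assumes blocks: "block_structure b n m"
    and p_pos: "\<forall>i\<in>{1..n}. 0 < p i"
    and f_diff: "f differentiable_on UNIV"
    and h_convex: "\<forall>i\<in>{1..n}. \<forall>j\<in>{1..p i}. convex_on (blockspace b i) (h i j)"
    and h_diff: "\<forall>i\<in>{1..n}. \<forall>j\<in>{1..p i}. h i j differentiable_on blockspace b i"
    and \<epsilon>bar_pos: "0 < \<epsilon>bar" and l_gt: "1 < l"
    and \<epsilon>_def: "\<forall>k. \<epsilon> k = \<epsilon>bar / (real k + 1) powr l"
    and L_def: "L = Max (Lc ` {1..n})"
    and \<gamma>_gt: "1 < \<gamma>"
    and run: "palm_run b n p f h (\<gamma> * L) M \<epsilon> z \<sigma>"
    and zb0: "zb0 \<in> blockprod b n (feas b p h)"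
    and zb_def: "zb = palm_exact b n p f h z \<sigma> zb0"
    and lipschitz: "\<forall>i\<in>{1..n}. 0 < Lc i \<and>
        (\<forall>z1\<in>blockprod b n (feas_bar b p h \<epsilon>bar). \<forall>z2\<in>blockprod b n (feas_bar b p h \<epsilon>bar).
           norm (partial_grad b f i z1 - partial_grad b f i z2) \<le> Lc i * norm (z1 - z2))"
    and constraints: "\<forall>i\<in>{1..n}. convex (feas b p h i) \<and> compact (feas b p h i) \<and>
        (\<exists>c\<ge>0. \<forall>x\<in>feas_tilde b n p f h \<epsilon>bar (\<gamma> * L) i.
           infdist x (feas b p h i) \<le> c * L2_set (\<lambda>j. max (h i j x) 0) {1..p i})"
begin

abbreviation "S \<equiv> feas b p h"
abbreviation "X \<equiv> blockprod b n S"
abbreviation "Xbar \<equiv> blockprod b n (feas_bar b p h \<epsilon>bar)"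
abbreviation "pg \<equiv> partial_grad b f"
abbreviation "step k \<equiv> norm (zb (Suc k) - zb k)"

lemma block_index: "\<forall>d. b d \<in> {1..n}" and n_pos: "0 < n"
  using blocks by (auto simp: block_structure_def)

lemma L_pos: "0 < L"
proof -
  have "Lc 1 \<le> L" unfolding L_def using n_pos by (intro Max_ge) auto
  moreover have "0 < Lc 1" using lipschitz n_pos by auto
  ultimately show ?thesis by simp
qed

lemma pg_lipschitz:
  assumes "i \<in> {1..n}" "x \<in> Xbar" "y \<in> Xbar"
  shows "norm (pg i x - pg i y) \<le> L * norm (x - y)"
proof -
  have "norm (pg i x - pg i y) \<le> Lc i * norm (x - y)" using lipschitz assms by blast
  also have "\<dots> \<le> L * norm (x - y)"
    unfolding L_def using assms by (intro mult_right_mono Max_ge) auto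
  finally show ?thesis .
qed

lemma f_gradient: "(f has_derivative (\<lambda>v. grad_in UNIV f x \<bullet> v)) (at x)"
  using grad_in_props(2)[of UNIV x f] f_diff by (simp add: differentiable_on_def)

lemma pg_eq: "pg i x = blockpart b i (grad_in UNIV f x)"
  by (rule partial_grad_eq_blockpart[OF f_gradient])

lemma f_continuous: "continuous_on UNIV f"
  using f_diff by (rule differentiable_imp_continuous_on)

lemma S_nonempty: "i \<in> {1..n} \<Longrightarrow> S i \<noteq> {}"
  using zb0 by (auto simp: blockprod_def)

lemma S_blockspace: "S i \<subseteq> blockspace b i"
  by (auto simp: feas_def)

lemma S_convex: "i \<in> {1..n} \<Longrightarrow> convex (S i)"
  and S_compact: "i \<in> {1..n} \<Longrightarrow> compact (S i)"
  using constraints by auto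

lemma S_closed: "i \<in> {1..n} \<Longrightarrow> closed (S i)"
  by (simp add: S_compact compact_imp_closed)

lemma Xbar_iff: "x \<in> Xbar \<longleftrightarrow> (\<forall>i\<in>{1..n}. infdist (blockpart b i x) (S i) \<le> \<epsilon>bar)"
  by (auto simp: blockprod_def feas_bar_def)

lemma X_subset_Xbar: "X \<subseteq> Xbar"
  using \<epsilon>bar_pos by (auto simp: Xbar_iff) (auto simp: blockprod_def)

lemma mixed_in_blockprod:
  "y \<in> blockprod b n A \<Longrightarrow> x \<in> blockprod b n A \<Longrightarrow> mixed b i y x \<in> blockprod b n A"
  by (auto simp: blockprod_def blockpart_mixed)

lemma X_convex: "convex X"
proof (rule convexI)
  fix x y and u v :: real assume a: "x \<in> X" "y \<in> X" "0 \<le> u" "0 \<le> v" "u + v = 1"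
  show "u *\<^sub>R x + v *\<^sub>R y \<in> X"
    using a S_convex by (auto simp: blockprod_def blockpart_simps intro!: convexD)
qed

lemma X_closed: "closed X"
proof -
  have "X = (\<Inter>i\<in>{1..n}. blockpart b i -` S i)" by (auto simp: blockprod_def)
  moreover have "closed (blockpart b i -` S i)" if "i \<in> {1..n}" for i
    using S_closed[OF that]
    by (rule closed_vimage) (simp add: linear_continuous_on linear_blockpart linear_conv_bounded_linear[symmetric])
  ultimately show ?thesis by auto
qed

lemma Xbar_bounded: obtains R where "0 \<le> R" "\<And>x. x \<in> Xbar \<Longrightarrow> norm x \<le> R"
  "\<And>i y. i \<in> {1..n} \<Longrightarrow> y \<in> S i \<Longrightarrow> norm y \<le> R"
proof -
  have "\<exists>R. \<forall>y\<in>S i. norm y \<le> R" if "i \<in> {1..n}" for i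
    using compact_imp_bounded[OF S_compact[OF that]] by (auto simp: bounded_iff)
  then obtain R where R: "\<And>i y. i \<in> {1..n} \<Longrightarrow> y \<in> S i \<Longrightarrow> norm y \<le> R i" by metis
  define Q where "Q = (\<Sum>i\<in>{1..n}. \<bar>R i\<bar> + \<epsilon>bar)"
  have i_le: "\<bar>R i\<bar> + \<epsilon>bar \<le> Q" if "i \<in> {1..n}" for i
    unfolding Q_def using that \<epsilon>bar_pos by (intro member_le_sum) auto
  show thesis
  proof (rule that[of Q])
    show "0 \<le> Q" unfolding Q_def using \<epsilon>bar_pos by (intro sum_nonneg) auto
    show "norm y \<le> Q" if "i \<in> {1..n}" "y \<in> S i" for i y
      using i_le[OF that(1)] R[OF that] \<epsilon>bar_pos by linarith
    fix x assume x: "x \<in> Xbar"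
    have "norm x \<le> (\<Sum>i\<in>{1..n}. norm (blockpart b i x))"
      by (rule norm_le_sum_blockparts[OF block_index])
    also have "\<dots> \<le> Q" unfolding Q_def
    proof (rule sum_mono)
      fix i assume i: "i \<in> {1..n}"
      obtain q where q: "q \<in> S i" "dist (blockpart b i x) q = infdist (blockpart b i x) (S i)"
        using infdist_attains_inf[OF S_closed[OF i] S_nonempty[OF i]] by metis
      then have "dist (blockpart b i x) q \<le> \<epsilon>bar" using x i by (simp add: Xbar_iff)
      moreover have "norm q \<le> \<bar>R i\<bar>" using R[OF i q(1)] by linarith
      ultimately show "norm (blockpart b i x) \<le> \<bar>R i\<bar> + \<epsilon>bar"
        using norm_triangle_sub[of "blockpart b i x" q] by (simp add: dist_norm)
    qed
    finally show "norm x \<le> Q" .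
  qed
qed

lemma pg_bounded: obtains G where "0 \<le> G" "\<And>i x. i \<in> {1..n} \<Longrightarrow> x \<in> Xbar \<Longrightarrow> norm (pg i x) \<le> G"
proof -
  obtain R where R: "0 \<le> R" "\<And>x. x \<in> Xbar \<Longrightarrow> norm x \<le> R" using Xbar_bounded by metis
  have z0: "zb0 \<in> Xbar" using zb0 X_subset_Xbar by auto
  define G where "G = (\<Sum>i\<in>{1..n}. norm (pg i zb0)) + L * (2 * R)"
  show thesis
  proof (rule that[of G])
    show "0 \<le> G" unfolding G_def using L_pos R by (intro add_nonneg_nonneg sum_nonneg) auto
    fix i x assume i: "i \<in> {1..n}" and x: "x \<in> Xbar"
    have "norm (x - zb0) \<le> 2 * R"
      using norm_triangle_ineq4[of x zb0] R(2)[OF x] R(2)[OF z0] by linarith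
    then have "L * norm (x - zb0) \<le> L * (2 * R)" using L_pos by simp
    with pg_lipschitz[OF i x z0] have "norm (pg i x - pg i zb0) \<le> L * (2 * R)" by linarith
    moreover have "norm (pg i zb0) \<le> (\<Sum>i\<in>{1..n}. norm (pg i zb0))"
      using i by (intro member_le_sum) auto
    ultimately show "norm (pg i x) \<le> G"
      using norm_triangle_sub[of "pg i x" "pg i zb0"] unfolding G_def by linarith
  qed
qed

text \<open>
  Since the radius of the larger neighbourhood is nonnegative, the constraint error bound is
  available on the \<open>\<epsilon>bar\<close>-neighbourhood of the feasible set, which is what
  \<open>error_bound_extends\<close> asks for.
\<close>

lemma feas_bar_subset_feas_tilde:
  assumes "i \<in> {1..n}"
  shows "feas_bar b p h \<epsilon>bar i \<subseteq> feas_tilde b n p f h \<epsilon>bar (\<gamma> * L) i"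
proof -
  obtain G where G: "\<And>x. x \<in> Xbar \<Longrightarrow> norm (pg i x) \<le> G" using pg_bounded assms by metis
  have "norm (pg i zb0) \<le> grad_bound b n p f h \<epsilon>bar i"
    unfolding grad_bound_def using zb0 X_subset_Xbar G
    by (intro cSUP_upper bdd_aboveI2[of _ _ G]) auto
  then have "0 \<le> grad_bound b n p f h \<epsilon>bar i" using norm_ge_zero order_trans by blast
  then have "0 \<le> grad_bound b n p f h \<epsilon>bar i / (\<gamma> * L)" using \<gamma>_gt L_pos by simp
  then show ?thesis by (auto simp: feas_tilde_def feas_bar_def)
qed

lemma global_error_bound:
  obtains c where "0 \<le> c" "\<And>i x. i \<in> {1..n} \<Longrightarrow> x \<in> blockspace b i \<Longrightarrow>
    infdist x (S i) \<le> c * L2_set (\<lambda>j. max (h i j x) 0) {1..p i}"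
proof -
  have "\<exists>c\<ge>0. \<forall>x\<in>blockspace b i. infdist x (S i) \<le> c * L2_set (\<lambda>j. max (h i j x) 0) {1..p i}"
    if i: "i \<in> {1..n}" for i
  proof -
    obtain c where c: "c \<ge> 0" and loc: "\<And>x. x \<in> feas_tilde b n p f h \<epsilon>bar (\<gamma> * L) i \<Longrightarrow>
        infdist x (S i) \<le> c * L2_set (\<lambda>j. max (h i j x) 0) {1..p i}"
      using constraints i by blast
    have "infdist x (S i) \<le> c * L2_set (\<lambda>j. max (h i j x) 0) {1..p i}" if x: "x \<in> blockspace b i" for x
    proof (rule error_bound_extends[OF subspace_blockspace feas_def S_nonempty[OF i] S_closed[OF i] _ \<epsilon>bar_pos c _ x])
      show "convex_on (blockspace b i) (h i j)" if "j \<in> {1..p i}" for j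
        using h_convex i that by blast
      show "infdist x (S i) \<le> c * L2_set (\<lambda>j. max (h i j x) 0) {1..p i}"
        if "x \<in> blockspace b i" "infdist x (S i) \<le> \<epsilon>bar" for x
        using loc feas_bar_subset_feas_tilde[OF i] that by (auto simp: feas_bar_def)
    qed
    with c show ?thesis by blast
  qed
  then obtain c where c: "\<And>i. i \<in> {1..n} \<Longrightarrow> 0 \<le> c i"
    "\<And>i x. i \<in> {1..n} \<Longrightarrow> x \<in> blockspace b i \<Longrightarrow>
      infdist x (S i) \<le> c i * L2_set (\<lambda>j. max (h i j x) 0) {1..p i}" by metis
  show thesis
  proof (rule that[of "\<Sum>i\<in>{1..n}. c i"])
    show "0 \<le> (\<Sum>i\<in>{1..n}. c i)" using c by (intro sum_nonneg) auto
    fix i x assume i: "i \<in> {1..n}" and x: "x \<in> blockspace b i"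
    have "c i \<le> (\<Sum>i\<in>{1..n}. c i)" using i c by (intro member_le_sum) auto
    then show "infdist x (S i) \<le> (\<Sum>i\<in>{1..n}. c i) * L2_set (\<lambda>j. max (h i j x) 0) {1..p i}"
      by (intro order_trans[OF c(2)[OF i x]] mult_right_mono) auto
  qed
qed

lemma \<sigma>_bounds: "i \<in> {1..n} \<Longrightarrow> \<gamma> * L \<le> \<sigma> k i" "i \<in> {1..n} \<Longrightarrow> \<sigma> k i \<le> M"
  using run by (auto simp: palm_run_def)

lemma \<sigma>_pos: "i \<in> {1..n} \<Longrightarrow> 0 < \<sigma> k i"
  using \<sigma>_bounds(1)[of i k] \<gamma>_gt L_pos mult_pos_pos[of \<gamma> L] by linarith

lemma M_nonneg: "0 \<le> M"
  using \<sigma>_pos[of 1 0] \<sigma>_bounds(2)[of 1 0] n_pos by auto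

lemma \<epsilon>_eq: "\<epsilon> k = \<epsilon>bar * real (Suc k) powr - l"
  using \<epsilon>_def by (simp add: powr_minus divide_inverse add.commute)

lemma \<epsilon>_nonneg: "0 \<le> \<epsilon> k"
  using \<epsilon>bar_pos by (simp add: \<epsilon>_eq)

lemma residual_witness:
  assumes "i \<in> {1..n}"
  obtains lam where "\<forall>j\<in>{1..p i}. 0 \<le> lam j"
    "residual b p h i (blockpart b i (z (Suc k))) lam (palm_center b f \<sigma> z k i) \<le> (\<epsilon> k)\<^sup>2"
proof -
  obtain lam where "\<forall>j\<in>{1..p i}. 0 \<le> lam j"
    "sqrt (residual b p h i (blockpart b i (z (Suc k))) lam (palm_center b f \<sigma> z k i)) \<le> \<epsilon> k"
    using run assms unfolding palm_run_def by meson
  then show thesis using that sqrt_le_D by blast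
qed

text \<open>
  The error bound holds everywhere, so the infeasibility of an iterate is controlled by its residual
  even if the previous iterate lies where the gradient of \<open>f\<close> is uncontrolled.
\<close>

lemma iterate_infdist:
  obtains c where "0 \<le> c"
    "\<And>k i. i \<in> {1..n} \<Longrightarrow> infdist (blockpart b i (z (Suc k))) (S i) \<le> c * (\<epsilon> k)\<^sup>2"
proof -
  obtain c where c: "0 \<le> c" and eb: "\<And>i x. i \<in> {1..n} \<Longrightarrow> x \<in> blockspace b i \<Longrightarrow>
    infdist x (S i) \<le> c * L2_set (\<lambda>j. max (h i j x) 0) {1..p i}" using global_error_bound by blast
  define P where "P = (\<Sum>i\<in>{1..n}. real (p i))"
  have P: "0 \<le> P" by (simp add: P_def sum_nonneg)
  show thesis
  proof (rule that[of "c * P"])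
    show "0 \<le> c * P" using c P by simp
    fix k i assume i: "i \<in> {1..n}"
    let ?x = "blockpart b i (z (Suc k))"
    obtain lam where lam: "residual b p h i ?x lam (palm_center b f \<sigma> z k i) \<le> (\<epsilon> k)\<^sup>2"
      using residual_witness[OF i] by blast
    have "L2_set (\<lambda>j. max (h i j ?x) 0) {1..p i} \<le> (\<Sum>j\<in>{1..p i}. max (h i j ?x) 0)"
      by (rule L2_set_le_sum) auto
    also have "\<dots> \<le> (\<Sum>j\<in>{1..p i}. (\<epsilon> k)\<^sup>2)"
      using p_pos i by (intro sum_mono residual_parts(3)[OF lam _ refl]) auto
    also have "\<dots> = real (p i) * (\<epsilon> k)\<^sup>2" by simp
    also have "\<dots> \<le> P * (\<epsilon> k)\<^sup>2"
      unfolding P_def using i by (intro mult_right_mono member_le_sum) auto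
    finally have "c * L2_set (\<lambda>j. max (h i j ?x) 0) {1..p i} \<le> c * (P * (\<epsilon> k)\<^sup>2)"
      using c by (rule mult_left_mono)
    with eb[OF i, of ?x] show "infdist ?x (S i) \<le> c * P * (\<epsilon> k)\<^sup>2"
      by (simp add: mult.assoc)
  qed
qed

lemma iterates_eventually_Xbar: "\<forall>\<^sub>F k in sequentially. z k \<in> Xbar"
proof -
  obtain c where "0 \<le> c" and c: "\<And>k i. i \<in> {1..n} \<Longrightarrow> infdist (blockpart b i (z (Suc k))) (S i) \<le> c * (\<epsilon> k)\<^sup>2"
    using iterate_infdist by blast
  have "filterlim (\<lambda>k. real (Suc k)) at_top sequentially"
    by (rule filterlim_compose[OF filterlim_real_sequentially filterlim_Suc])
  then have "(\<lambda>k. real (Suc k) powr - l) \<longlonglongrightarrow> 0"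
    using l_gt by (intro tendsto_neg_powr) simp_all
  then have "(\<lambda>k. c * (\<epsilon> k)\<^sup>2) \<longlonglongrightarrow> c * (\<epsilon>bar * 0)\<^sup>2"
    unfolding \<epsilon>_eq by (intro tendsto_intros)
  then have "\<forall>\<^sub>F k in sequentially. c * (\<epsilon> k)\<^sup>2 < \<epsilon>bar"
    by (rule order_tendstoD) (use \<epsilon>bar_pos in simp)
  then have "\<forall>\<^sub>F k in sequentially. z (Suc k) \<in> Xbar"
  proof eventually_elim
    case (elim k)
    then show ?case unfolding Xbar_iff using c[of _ k] by force
  qed
  then show ?thesis using eventually_sequentially_Suc[of "\<lambda>k. z k \<in> Xbar"] by blast
qed

text \<open>
  The blocks of \<open>zb (Suc k)\<close> are the minimisers themselves, as each minimiser lives in its own block.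
\<close>

lemma exact_block:
  assumes i: "i \<in> {1..n}"
  shows "blockpart b i (zb (Suc k)) \<in> S i"
    and "\<forall>x\<in>S i. dist (palm_center b f \<sigma> z k i) (blockpart b i (zb (Suc k)))
           \<le> dist (palm_center b f \<sigma> z k i) x"
proof -
  define y where "y = (\<lambda>i. arg_min
        (\<lambda>x. palm_grad b f z k i \<bullet> (x - blockpart b i (z k))
              + \<sigma> k i / 2 * (norm (x - blockpart b i (z k)))\<^sup>2) (\<lambda>x. x \<in> S i))"
  have y: "y i \<in> S i \<and> (\<forall>x\<in>S i. dist (palm_center b f \<sigma> z k i) (y i)
           \<le> dist (palm_center b f \<sigma> z k i) x)" if "i \<in> {1..n}" for i
    unfolding palm_center_def
    by (rule proximal_arg_min[OF S_compact[OF that] S_nonempty[OF that] \<sigma>_pos[OF that]]) (simp add: y_def)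
  have "blockpart b i (zb (Suc k)) = (\<Sum>j\<in>{1..n}. blockpart b i (y j))"
    by (simp add: zb_def y_def linear_sum[OF linear_blockpart])
  also have "\<dots> = (\<Sum>j\<in>{1..n}. if j = i then y i else 0)"
  proof (intro sum.cong refl)
    fix j assume "j \<in> {1..n}"
    then have "y j \<in> blockspace b j" using y S_blockspace by blast
    then show "blockpart b i (y j) = (if j = i then y i else 0)"
      by (auto simp: blockpart_same blockpart_other)
  qed
  also have "\<dots> = y i" using i by simp
  finally have "blockpart b i (zb (Suc k)) = y i" .
  with y[OF i] show "blockpart b i (zb (Suc k)) \<in> S i"
    and "\<forall>x\<in>S i. dist (palm_center b f \<sigma> z k i) (blockpart b i (zb (Suc k)))
           \<le> dist (palm_center b f \<sigma> z k i) x" by auto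
qed

lemma exact_in_X: "zb k \<in> X"
  by (cases k) (use zb0 exact_block(1) in \<open>auto simp: zb_def blockprod_def\<close>)

lemma exact_variational:
  assumes i: "i \<in> {1..n}" and x: "x \<in> S i"
  shows "palm_grad b f z k i \<bullet> (blockpart b i (zb (Suc k)) - x)
    \<le> \<sigma> k i * (blockpart b i (zb (Suc k) - z k) \<bullet> (x - blockpart b i (zb (Suc k))))"
proof -
  let ?y = "blockpart b i (zb (Suc k))" and ?c = "palm_center b f \<sigma> z k i"
  have "(?c - ?y) \<bullet> (x - ?y) \<le> 0"
    by (rule any_closest_point_dot[OF S_convex[OF i] S_closed[OF i] exact_block(1)[OF i] x
          exact_block(2)[OF i]])
  then have "\<sigma> k i * ((?c - ?y) \<bullet> (x - ?y)) \<le> 0"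
    using \<sigma>_pos[OF i, of k] by (intro mult_nonneg_nonpos) auto
  then have "(\<sigma> k i *\<^sub>R (?c - ?y)) \<bullet> (x - ?y) \<le> 0" by simp
  moreover have "\<sigma> k i *\<^sub>R (?c - ?y) = - (\<sigma> k i *\<^sub>R blockpart b i (zb (Suc k) - z k)) - palm_grad b f z k i"
    using \<sigma>_pos[OF i, of k] by (simp add: palm_center_def blockpart_simps algebra_simps)
  moreover have "palm_grad b f z k i \<bullet> (?y - x) = - (palm_grad b f z k i \<bullet> (x - ?y))"
    by (simp add: inner_diff_right)
  ultimately show ?thesis by (simp add: inner_diff_left)
qed

text \<open>
  Once the iterates have entered \<open>Xbar\<close>, the gradients and the projection centres are bounded, so
  the constant of \<open>inexact_projection\<close> is uniform in \<open>k\<close> and the exact solutions are within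
  a constant times \<open>\<epsilon> (k - 1)\<close> of the iterates.
\<close>

lemma exact_distance:
  obtains B K where "0 \<le> B" "1 \<le> K" "\<And>k. K \<le> k \<Longrightarrow> z k \<in> Xbar"
    "\<And>k. K \<le> k \<Longrightarrow> norm (zb k - z k) \<le> B * real k powr - l"
proof -
  obtain c where c: "0 \<le> c"
    "\<And>k i. i \<in> {1..n} \<Longrightarrow> infdist (blockpart b i (z (Suc k))) (S i) \<le> c * (\<epsilon> k)\<^sup>2"
    using iterate_infdist by blast
  obtain R where R: "0 \<le> R" "\<And>x. x \<in> Xbar \<Longrightarrow> norm x \<le> R"
    "\<And>i y. i \<in> {1..n} \<Longrightarrow> y \<in> S i \<Longrightarrow> norm y \<le> R" using Xbar_bounded by metis
  obtain G where G: "0 \<le> G" "\<And>i x. i \<in> {1..n} \<Longrightarrow> x \<in> Xbar \<Longrightarrow> norm (pg i x) \<le> G"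
    using pg_bounded by metis
  obtain K where K: "\<And>k. K \<le> k \<Longrightarrow> z k \<in> Xbar"
    using iterates_eventually_Xbar unfolding eventually_sequentially by blast
  define D where "D = R + 1 / (\<gamma> * L) * G + R"
  define C where "C = R * sqrt (real (DIM(real ^ 'd))) + 2 + D * c"
  have "0 \<le> D" unfolding D_def using R G \<gamma>_gt L_pos by simp
  then have C: "0 \<le> C" unfolding C_def using R c by simp
  define B where "B = real n * (sqrt C * \<epsilon>bar)"
  have step_bound: "norm (zb (Suc k) - z (Suc k)) \<le> B * real (Suc k) powr - l" if k: "K \<le> k" for k
  proof -
    have block: "norm (blockpart b i (zb (Suc k) - z (Suc k))) \<le> sqrt C * \<epsilon> k" if i: "i \<in> {1..n}" for i
    proof -
      let ?x = "blockpart b i (z (Suc k))" and ?y = "blockpart b i (zb (Suc k))"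
        and ?c = "palm_center b f \<sigma> z k i"
      obtain lam where lam: "\<forall>j\<in>{1..p i}. 0 \<le> lam j" "residual b p h i ?x lam ?c \<le> (\<epsilon> k)\<^sup>2"
        using residual_witness[OF i] by blast
      have "norm (palm_grad b f z k i) \<le> G"
        unfolding palm_grad_def using K k i by (intro G(2) mixed_in_blockprod) auto
      then have "1 / \<sigma> k i * norm (palm_grad b f z k i) \<le> 1 / (\<gamma> * L) * G"
        using \<sigma>_pos[OF i, of k] \<sigma>_bounds(1)[OF i, of k] \<gamma>_gt L_pos
        by (intro mult_mono divide_left_mono) auto
      moreover have "norm (blockpart b i (z k)) \<le> R"
        using R(2)[OF K[OF k]] norm_blockpart_le order_trans by blast
      moreover have "norm ?c \<le> norm (blockpart b i (z k)) + norm ((1 / \<sigma> k i) *\<^sub>R palm_grad b f z k i)"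
        unfolding palm_center_def by (rule norm_triangle_ineq4)
      moreover have "norm ((1 / \<sigma> k i) *\<^sub>R palm_grad b f z k i) = 1 / \<sigma> k i * norm (palm_grad b f z k i)"
        using \<sigma>_pos[OF i, of k] by simp
      ultimately have "norm ?c \<le> R + 1 / (\<gamma> * L) * G" by linarith
      moreover have Ry: "norm ?y \<le> R" using R(3)[OF i exact_block(1)[OF i]] .
      ultimately have D: "dist ?c ?y \<le> D"
        unfolding D_def dist_norm using norm_triangle_ineq4[of ?c ?y] by linarith
      have "(norm (?x - ?y))\<^sup>2 \<le> C * (\<epsilon> k)\<^sup>2"
        unfolding C_def
      proof (rule inexact_projection[OF _ lam _ _ _ S_convex[OF i] S_closed[OF i] exact_block[OF i] c(2)[OF i] Ry D])
        show "0 < p i" using p_pos i by blast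
        show "convex_on (blockspace b i) (h i j)" "h i j differentiable_on blockspace b i"
          if "j \<in> {1..p i}" for j using h_convex h_diff i that by blast+
      qed simp
      then have "norm (?x - ?y) \<le> sqrt (C * (\<epsilon> k)\<^sup>2)" by (rule real_le_rsqrt)
      then have "norm (?x - ?y) \<le> sqrt C * \<epsilon> k" using \<epsilon>_nonneg[of k] by (simp add: real_sqrt_mult)
      then show ?thesis by (simp add: blockpart_simps norm_minus_commute)
    qed
    have "norm (zb (Suc k) - z (Suc k)) \<le> (\<Sum>i\<in>{1..n}. norm (blockpart b i (zb (Suc k) - z (Suc k))))"
      by (rule norm_le_sum_blockparts[OF block_index])
    also have "\<dots> \<le> (\<Sum>i\<in>{1..n}. sqrt C * \<epsilon> k)" by (rule sum_mono[OF block])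
    also have "\<dots> = B * real (Suc k) powr - l" by (simp add: B_def \<epsilon>_eq)
    finally show ?thesis .
  qed
  show thesis
  proof (rule that[of B "Suc K"])
    show "0 \<le> B" using C \<epsilon>bar_pos by (simp add: B_def)
    show "z k \<in> Xbar" if "Suc K \<le> k" for k using that K by simp
    show "norm (zb k - z k) \<le> B * real k powr - l" if "Suc K \<le> k" for k
      using that step_bound[of "k - 1"] by (cases k) auto
  qed simp
qed

section \<open>Descent and subgradients along the exact solutions\<close>

text \<open>
  Replace the \<open>i\<close>-th block of the exact solution.  By the mean value theorem the change of \<open>f\<close> is
  \<open>pg i \<xi> \<bullet> d\<close> with \<open>\<xi>\<close> on the segment.  Moving from \<open>\<xi>\<close> to the left end costs \<open>L * (norm d)\<^sup>2\<close>,
  moving on to the point where the algorithm took the gradient costs \<open>2 * L * \<delta> * norm d\<close>, and the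
  variational inequality supplies \<open>- \<gamma> * L * (norm d)\<^sup>2 + M * \<delta> * norm d\<close>.  Since \<open>1 < \<gamma>\<close>, a negative
  quadratic term is left, half of which absorbs the terms linear in \<open>norm d\<close>.
\<close>

lemma block_descent:
  assumes zX: "z k \<in> Xbar" "z (Suc k) \<in> Xbar"
    and \<delta>: "norm (zb k - z k) \<le> \<delta>" "norm (zb (Suc k) - z (Suc k)) \<le> \<delta>"
    and i: "i \<in> {1..n}"
  shows "f (mixed b (Suc i) (zb (Suc k)) (zb k)) + (\<gamma> - 1) * L / 2 * (norm (blockpart b i (zb (Suc k) - zb k)))\<^sup>2
    \<le> f (mixed b i (zb (Suc k)) (zb k)) + (M + 2 * L)\<^sup>2 / (2 * ((\<gamma> - 1) * L)) * \<delta>\<^sup>2"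
proof -
  let ?y = "zb k" and ?y' = "zb (Suc k)"
  define u where "u = mixed b i ?y' ?y"
  define d where "d = blockpart b i (?y' - ?y)"
  define \<kappa> where "\<kappa> = (\<gamma> - 1) * L"
  have \<kappa>: "0 < \<kappa>" using \<gamma>_gt L_pos by (simp add: \<kappa>_def)
  have u': "mixed b (Suc i) ?y' ?y = u + d"
    by (auto simp: u_def d_def mixed_def blockpart_def vec_eq_iff)
  have uX: "u \<in> X" "u + d \<in> X"
    unfolding u'[symmetric] unfolding u_def by (auto intro: mixed_in_blockprod exact_in_X)
  obtain t where t: "0 < t" "t < 1" and mvt: "f (u + d) - f u = grad_in UNIV f (u + t *\<^sub>R d) \<bullet> d"
    using mean_value_gradient[OF f_gradient] by metis
  define \<xi> where "\<xi> = u + t *\<^sub>R d"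
  have "\<xi> = (1 - t) *\<^sub>R u + t *\<^sub>R (u + d)" by (simp add: \<xi>_def algebra_simps)
  then have \<xi>X: "\<xi> \<in> X" using convexD[OF X_convex uX, of "1 - t" t] t by simp
  have dV: "d = blockpart b i d" by (simp add: d_def blockpart_same)
  have pg_d: "pg i x \<bullet> d = grad_in UNIV f x \<bullet> d" for x
  proof -
    have "pg i x \<bullet> d = d \<bullet> blockpart b i (grad_in UNIV f x)"
      by (simp add: pg_eq inner_commute)
    also have "\<dots> = d \<bullet> grad_in UNIV f x"
      by (subst (1 2) dV) (rule blockpart_inner[symmetric])
    finally show ?thesis by (simp add: inner_commute)
  qed
  have 1: "(pg i \<xi> - pg i u) \<bullet> d \<le> L * norm d * norm d"
  proof -
    have "norm (pg i \<xi> - pg i u) \<le> L * norm (\<xi> - u)"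
      using \<xi>X uX X_subset_Xbar i by (intro pg_lipschitz) auto
    also have "\<dots> \<le> L * norm d"
      unfolding \<xi>_def using t L_pos by (intro mult_left_mono) (auto intro: mult_left_le_one_le)
    finally show ?thesis
      by (intro order_trans[OF norm_cauchy_schwarz] mult_right_mono) auto
  qed
  have 2: "(pg i u - palm_grad b f z k i) \<bullet> d \<le> L * (2 * \<delta>) * norm d"
  proof -
    have "u - mixed b i (z (Suc k)) (z k) = mixed b i (?y' - z (Suc k)) (?y - z k)"
      by (simp add: u_def mixed_diff)
    then have "norm (u - mixed b i (z (Suc k)) (z k)) \<le> 2 * \<delta>"
      using norm_mixed_le[of b i "?y' - z (Suc k)" "?y - z k"] \<delta> by simp
    then have "L * norm (u - mixed b i (z (Suc k)) (z k)) \<le> L * (2 * \<delta>)" using L_pos by simp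
    moreover have "norm (pg i u - palm_grad b f z k i) \<le> L * norm (u - mixed b i (z (Suc k)) (z k))"
      unfolding palm_grad_def using uX X_subset_Xbar zX i
      by (intro pg_lipschitz mixed_in_blockprod) auto
    ultimately have "norm (pg i u - palm_grad b f z k i) \<le> L * (2 * \<delta>)" by linarith
    then show ?thesis by (intro order_trans[OF norm_cauchy_schwarz] mult_right_mono) auto
  qed
  have 3: "palm_grad b f z k i \<bullet> d \<le> - (\<gamma> * L) * (norm d)\<^sup>2 + M * \<delta> * norm d"
  proof -
    let ?e = "blockpart b i (?y - z k)"
    have "palm_grad b f z k i \<bullet> d
        \<le> \<sigma> k i * (blockpart b i (?y' - z k) \<bullet> (blockpart b i ?y - blockpart b i ?y'))"
      using exact_variational[OF i, of "blockpart b i ?y" k] exact_in_X[of k] i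
      by (auto simp: d_def blockpart_simps blockprod_def)
    also have "blockpart b i (?y' - z k) \<bullet> (blockpart b i ?y - blockpart b i ?y')
        = - ((norm d)\<^sup>2) - ?e \<bullet> d"
      by (simp add: d_def blockpart_simps power2_norm_eq_inner algebra_simps inner_commute)
    also have "\<sigma> k i * (- ((norm d)\<^sup>2) - ?e \<bullet> d) = - (\<sigma> k i * (norm d)\<^sup>2) + \<sigma> k i * (- ?e \<bullet> d)"
      by (simp add: algebra_simps)
    also have "\<dots> \<le> - (\<gamma> * L * (norm d)\<^sup>2) + M * (\<delta> * norm d)"
    proof (intro add_mono)
      show "- (\<sigma> k i * (norm d)\<^sup>2) \<le> - (\<gamma> * L * (norm d)\<^sup>2)"
        using \<sigma>_bounds(1)[OF i, of k] by (simp add: mult_right_mono)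
      have "norm (- ?e) \<le> \<delta>" using norm_blockpart_le[of b i "?y - z k"] \<delta>(1) by simp
      then have "- ?e \<bullet> d \<le> \<delta> * norm d"
        by (intro order_trans[OF norm_cauchy_schwarz] mult_right_mono) auto
      moreover have "0 \<le> \<delta> * norm d" using \<delta>(1) by (simp add: order_trans[OF norm_ge_zero])
      ultimately show "\<sigma> k i * (- ?e \<bullet> d) \<le> M * (\<delta> * norm d)"
        using \<sigma>_bounds(2)[OF i, of k] \<sigma>_pos[OF i, of k] M_nonneg
        by (meson less_imp_le mult_left_mono mult_right_mono order_trans)
    qed
    finally show ?thesis by (simp add: algebra_simps)
  qed
  have "f (u + d) - f u = (pg i \<xi> - pg i u) \<bullet> d + (pg i u - palm_grad b f z k i) \<bullet> d
      + palm_grad b f z k i \<bullet> d"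
    using mvt pg_d[of \<xi>] by (simp add: \<xi>_def inner_diff_left)
  also have "\<dots> \<le> L * norm d * norm d + L * (2 * \<delta>) * norm d + (- (\<gamma> * L) * (norm d)\<^sup>2 + M * \<delta> * norm d)"
    using 1 2 3 by linarith
  also have "\<dots> = - \<kappa> * (norm d)\<^sup>2 + (M + 2 * L) * \<delta> * norm d"
    by (simp add: \<kappa>_def algebra_simps power2_eq_square)
  also have "\<dots> \<le> - (\<kappa> / 2) * (norm d)\<^sup>2 + (M + 2 * L)\<^sup>2 / (2 * \<kappa>) * \<delta>\<^sup>2"
  proof -
    \<comment> \<open>Young's inequality, from a completed square.\<close>
    have "0 \<le> (\<kappa> * norm d - (M + 2 * L) * \<delta>)\<^sup>2 / (2 * \<kappa>)" using \<kappa> by simp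
    also have "\<dots> = \<kappa> / 2 * (norm d)\<^sup>2 - (M + 2 * L) * \<delta> * norm d + (M + 2 * L)\<^sup>2 / (2 * \<kappa>) * \<delta>\<^sup>2"
      using \<kappa> by (simp add: power2_diff power_mult_distrib diff_divide_distrib add_divide_distrib)
        (simp add: power2_eq_square)
    finally show ?thesis by simp
  qed
  finally show ?thesis unfolding u'  \<kappa>_def[symmetric] u_def[symmetric] d_def[symmetric] by simp
qed

text \<open>
  Updating one block after the other keeps the Lipschitz constant \<open>L\<close> of a single block; moving
  all blocks at once would bring in the Lipschitz constant of the full gradient, which may exceed
  \<open>\<gamma> * L\<close>.
\<close>

lemma sufficient_descent:
  assumes zX: "z k \<in> Xbar" "z (Suc k) \<in> Xbar"
    and \<delta>: "norm (zb k - z k) \<le> \<delta>" "norm (zb (Suc k) - z (Suc k)) \<le> \<delta>"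
  shows "f (zb (Suc k)) + (\<gamma> - 1) * L / 2 * (step k)\<^sup>2
    \<le> f (zb k) + real n * ((M + 2 * L)\<^sup>2 / (2 * ((\<gamma> - 1) * L))) * \<delta>\<^sup>2"
proof -
  let ?P = "\<lambda>i. f (mixed b i (zb (Suc k)) (zb k))"
    and ?s = "\<lambda>i. (norm (blockpart b i (zb (Suc k) - zb k)))\<^sup>2"
  define \<kappa> where "\<kappa> = (\<gamma> - 1) * L / 2"
  define A where "A = (M + 2 * L)\<^sup>2 / (2 * ((\<gamma> - 1) * L)) * \<delta>\<^sup>2"
  have "?P (Suc N) + \<kappa> * (\<Sum>i\<in>{1..N}. ?s i) \<le> ?P 1 + real N * A" if "N \<le> n" for N
    using that
  proof (induction N)
    case (Suc N)
    have "?P (Suc (Suc N)) + \<kappa> * ?s (Suc N) \<le> ?P (Suc N) + A"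
      unfolding \<kappa>_def A_def by (rule block_descent[OF zX \<delta>]) (use Suc.prems in auto)
    with Suc.IH Suc.prems show ?case by (simp add: distrib_left distrib_right)
  qed simp
  from this[of n] have "?P (Suc n) + \<kappa> * (step k)\<^sup>2 \<le> ?P 1 + real n * A"
    by (simp only: norm_power2_blockparts[OF block_index, of "zb (Suc k) - zb k"] order_refl simp_thms)
  moreover have "mixed b (Suc n) (zb (Suc k)) (zb k) = zb (Suc k)"
    "mixed b 1 (zb (Suc k)) (zb k) = zb k"
    using block_index by (auto simp: mixed_def vec_eq_iff less_Suc_eq_le not_less)
      (metis One_nat_def le_0_eq less_Suc0 not_less_eq_eq)
  ultimately show ?thesis by (simp add: \<kappa>_def A_def mult.assoc)
qed

text \<open>
  By the optimality conditions of the block subproblems, the negative of the sum of the partial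
  gradients used and the proximal terms is normal to the feasible set.  Adding the gradient
  of \<open>f\<close> leaves the difference of gradients at nearby points and the proximal terms, both of the order of the last step and the inexactness.
\<close>

lemma small_subgradient:
  assumes zX: "z k \<in> Xbar" "z (Suc k) \<in> Xbar"
    and \<delta>: "norm (zb k - z k) \<le> \<delta>" "norm (zb (Suc k) - z (Suc k)) \<le> \<delta>"
  obtains u where "u \<in> frechet_subdiff (objF b n p f h) (zb (Suc k))"
    "norm u \<le> real n * (2 * L + M) * (step k + \<delta>)"
proof -
  let ?y' = "zb (Suc k)"
  define q where "q = (\<lambda>i. palm_grad b f z k i + \<sigma> k i *\<^sub>R blockpart b i (?y' - z k))"
  have qV: "blockpart b i (q i) = q i" for i
    by (simp add: q_def palm_grad_def pg_eq blockpart_simps blockpart_same)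
  let ?g = "grad_in UNIV f ?y'" and ?\<nu> = "- (\<Sum>i\<in>{1..n}. q i)"
  have "?g + ?\<nu> \<in> frechet_subdiff (objF b n p f h) ?y'"
  proof (rule frechet_subdiff_normal[where G = "objF b n p f h" and S = X and f = f, OF objF_eq exact_in_X f_gradient])
    fix x assume x: "x \<in> X"
    have "0 \<le> q i \<bullet> (x - ?y')" if i: "i \<in> {1..n}" for i
    proof -
      have xS: "blockpart b i x \<in> S i" using x i by (auto simp: blockprod_def)
      have "q i \<bullet> (x - ?y') = blockpart b i (q i) \<bullet> blockpart b i (x - ?y')"
        by (metis qV blockpart_inner)
      also have "\<dots> = \<sigma> k i * (blockpart b i (?y' - z k) \<bullet> (blockpart b i x - blockpart b i ?y'))
          - palm_grad b f z k i \<bullet> (blockpart b i ?y' - blockpart b i x)"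
        unfolding qV by (simp add: q_def blockpart_simps(2) inner_add_left inner_diff_right algebra_simps)
      finally show ?thesis using exact_variational[OF i xS, of k] by simp
    qed
    then show "?\<nu> \<bullet> (x - ?y') \<le> 0" by (auto simp: inner_sum_left intro!: sum_nonneg)
  qed
  moreover have "norm (?g + ?\<nu>) \<le> real n * (2 * L + M) * (step k + \<delta>)"
  proof -
    have "?g + ?\<nu> = (\<Sum>i\<in>{1..n}. pg i ?y' - q i)"
      using sum_blockpart[OF block_index, of ?g] by (simp add: sum_subtractf pg_eq)
    then have "norm (?g + ?\<nu>) \<le> (\<Sum>i\<in>{1..n}. norm (pg i ?y' - q i))" by (simp add: norm_sum)
    also have "\<dots> \<le> (\<Sum>i\<in>{1..n}. (2 * L + M) * (step k + \<delta>))"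
    proof (rule sum_mono)
      fix i assume i: "i \<in> {1..n}"
      have yz: "norm (?y' - z k) \<le> step k + \<delta>"
        using norm_triangle_ineq[of "?y' - zb k" "zb k - z k"] \<delta>(1) by simp
      have "?y' - mixed b i (z (Suc k)) (z k) = mixed b i (?y' - z (Suc k)) (?y' - z k)"
        by (auto simp: mixed_def vec_eq_iff)
      then have "norm (?y' - mixed b i (z (Suc k)) (z k)) \<le> \<delta> + (step k + \<delta>)"
        using norm_mixed_le[of b i "?y' - z (Suc k)" "?y' - z k"] \<delta>(2) yz by simp
      also have "\<dots> \<le> 2 * (step k + \<delta>)" by simp
      finally have "L * norm (?y' - mixed b i (z (Suc k)) (z k)) \<le> L * (2 * (step k + \<delta>))"
        using L_pos by simp
      moreover have "norm (pg i ?y' - palm_grad b f z k i)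
          \<le> L * norm (?y' - mixed b i (z (Suc k)) (z k))"
        unfolding palm_grad_def using exact_in_X[of "Suc k"] X_subset_Xbar zX i
        by (intro pg_lipschitz mixed_in_blockprod) auto
      moreover have "norm (\<sigma> k i *\<^sub>R blockpart b i (?y' - z k)) \<le> M * (step k + \<delta>)"
        using \<sigma>_bounds(2)[OF i, of k] \<sigma>_pos[OF i, of k] M_nonneg yz norm_blockpart_le[of b i "?y' - z k"]
        by (auto intro!: mult_mono)
      moreover have "norm (pg i ?y' - q i) \<le> norm (pg i ?y' - palm_grad b f z k i)
          + norm (\<sigma> k i *\<^sub>R blockpart b i (?y' - z k))"
        unfolding q_def diff_diff_eq[symmetric] by (rule norm_triangle_ineq4)
      moreover have "(2 * L + M) * (step k + \<delta>) = L * (2 * (step k + \<delta>)) + M * (step k + \<delta>)"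
        by (simp add: algebra_simps)
      ultimately show "norm (pg i ?y' - q i) \<le> (2 * L + M) * (step k + \<delta>)" by linarith
    qed
    finally show ?thesis by simp
  qed
  ultimately show thesis using that by blast
qed

section \<open>Rate of convergence\<close>

lemma iterates_converge:
  assumes "\<And>w. seq_limit_point z w \<Longrightarrow> w = zlim"
  shows "z \<longlonglongrightarrow> zlim"
proof (rule bounded_unique_limit_point[OF _ assms])
  obtain R where R: "\<And>x. x \<in> Xbar \<Longrightarrow> norm x \<le> R" using Xbar_bounded by metis
  obtain K where K: "\<And>k. K \<le> k \<Longrightarrow> z k \<in> Xbar"
    using iterates_eventually_Xbar unfolding eventually_sequentially by blast
  have "range z = z ` {..<K} \<union> z ` {K..}" by (auto simp: image_Un[symmetric] ivl_disj_un)
  moreover have "bounded (z ` {K..})" using R K by (auto simp: bounded_iff intro!: exI[of _ R])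
  ultimately show "bounded (range z)" by (simp add: finite_imp_bounded)
qed

text \<open>
  Allowing an exponent \<open>\<Theta>\<close> above \<open>\<theta>\<close> is what lets one argument serve both rates: it brings the
  critical perturbation exponent \<open>\<Theta> / (2 * \<Theta> - 1)\<close> down to \<open>l\<close>.  The values of \<open>f\<close> at late exact solutions differ from
  \<open>f zlim\<close> by less than 1, so increasing the exponent weakens the Lojasiewicz inequality.
  A step may increase \<open>f\<close> by \<open>O(k powr - (2 * l))\<close>; the explicit term \<open>E k\<close> compensates for this, its decrement being at least as
  large, and \<open>a = \<phi> + E\<close> decreases to 0.
\<close>

lemma exact_rate:
  assumes uniq: "\<And>w. seq_limit_point z w \<Longrightarrow> w = zlim"
    and loj: "loj_exponent (objF b n p f h) zlim \<theta>"
    and \<Theta>: "\<theta> \<le> \<Theta>" "1 / 2 < \<Theta>" "\<Theta> < 1" and l: "\<Theta> / (2 * \<Theta> - 1) \<le> l"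
  shows "\<exists>C. \<forall>\<^sub>F k in sequentially. norm (z k - zlim) \<le> C * real k powr - ((1 - \<Theta>) / (2 * \<Theta> - 1))"
proof -
  define q where "q = \<Theta> / (2 * \<Theta> - 1)"
  define \<rho> where "\<rho> = (1 - \<Theta>) / (2 * \<Theta> - 1)"
  have ql: "q \<le> l" using l by (simp add: q_def)
  have \<rho>q: "\<rho> \<le> q" using \<Theta> by (auto simp: q_def \<rho>_def intro!: divide_right_mono)
  obtain B K0 where B: "0 \<le> B" and K0: "1 \<le> K0" and zX: "\<And>k. K0 \<le> k \<Longrightarrow> z k \<in> Xbar"
    and \<Delta>: "\<And>k. K0 \<le> k \<Longrightarrow> norm (zb k - z k) \<le> B * real k powr - l" using exact_distance by blast
  have \<Delta>': "norm (zb (Suc k) - z (Suc k)) \<le> B * real k powr - l" if k: "K0 \<le> k" for k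
  proof -
    have "real (Suc k) powr - l \<le> real k powr - l" using k K0 l_gt by (intro powr_mono2') auto
    with B have "B * real (Suc k) powr - l \<le> B * real k powr - l" by (rule mult_left_mono[rotated])
    with \<Delta>[of "Suc k"] k show ?thesis by linarith
  qed
  have z_lim: "z \<longlonglongrightarrow> zlim" by (rule iterates_converge[OF uniq])
  have k_l: "(\<lambda>k. real k powr - l) \<longlonglongrightarrow> 0"
    using l_gt by (intro tendsto_neg_powr filterlim_real_sequentially) simp
  have "(\<lambda>k. zb k - z k) \<longlonglongrightarrow> 0"
  proof (rule Lim_null_comparison)
    show "\<forall>\<^sub>F k in sequentially. norm (zb k - z k) \<le> B * real k powr - l"
      using \<Delta> by (auto simp: eventually_sequentially)
    show "(\<lambda>k. B * real k powr - l) \<longlonglongrightarrow> 0" using tendsto_mult_right_zero[OF k_l] .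
  qed
  from tendsto_add[OF this z_lim] have zb_lim: "zb \<longlonglongrightarrow> zlim" by simp
  have limX: "zlim \<in> X"
    by (rule Lim_in_closed_set[OF X_closed _ _ zb_lim]) (auto simp: exact_in_X)
  define \<phi> where "\<phi> = (\<lambda>k. f (zb k) - f zlim)"
  have "isCont f zlim" using f_continuous by (simp add: continuous_on_eq_continuous_at)
  then have "(\<lambda>k. f (zb k)) \<longlonglongrightarrow> f zlim" using zb_lim by (rule isCont_tendsto_compose)
  then have \<phi>_lim: "\<phi> \<longlonglongrightarrow> 0" unfolding \<phi>_def using LIM_zero by blast
  define \<beta> where "\<beta> = 2 * l - 1"
  have \<beta>: "0 < \<beta>" using l_gt by (simp add: \<beta>_def)
  define \<kappa> where "\<kappa> = (\<gamma> - 1) * L / 2"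
  have \<kappa>: "0 < \<kappa>" using \<gamma>_gt L_pos by (simp add: \<kappa>_def)
  define A where "A = real n * ((M + 2 * L)\<^sup>2 / (2 * ((\<gamma> - 1) * L))) * B\<^sup>2 / \<beta>"
  have A: "0 \<le> A" unfolding A_def using \<beta> \<gamma>_gt L_pos by simp
  define E where "E = (\<lambda>k. A * (real k - 1) powr - \<beta>)"
  define a where "a = (\<lambda>k. \<phi> k + E k)"
  have dec: "a (Suc k) + \<kappa> * (step k)\<^sup>2 \<le> a k" if k: "Suc K0 \<le> k" for k
  proof -
    have "f (zb (Suc k)) + \<kappa> * (step k)\<^sup>2
        \<le> f (zb k) + real n * ((M + 2 * L)\<^sup>2 / (2 * ((\<gamma> - 1) * L))) * (B * real k powr - l)\<^sup>2"
      unfolding \<kappa>_def using k by (intro sufficient_descent zX \<Delta> \<Delta>') auto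
    also have "real n * ((M + 2 * L)\<^sup>2 / (2 * ((\<gamma> - 1) * L))) * (B * real k powr - l)\<^sup>2
        = A * (\<beta> * (real k powr - l)\<^sup>2)"
      using \<beta> by (simp add: A_def power_mult_distrib)
    also have "(real k powr - l)\<^sup>2 = real k powr - (\<beta> + 1)"
      by (simp add: \<beta>_def power2_eq_square powr_add[symmetric])
    also have "A * (\<beta> * real k powr - (\<beta> + 1)) \<le> A * ((real k - 1) powr - \<beta> - real k powr - \<beta>)"
      using powr_neg_step(2)[of "real k - 1" \<beta>] \<beta> A k K0 by (intro mult_left_mono) auto
    finally show ?thesis by (simp add: a_def \<phi>_def E_def algebra_simps)
  qed
  have "filterlim (\<lambda>k. real k - 1) at_top sequentially"
    using filterlim_tendsto_add_at_top[OF tendsto_const[of "-1"] filterlim_real_sequentially]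
    by (simp add: algebra_simps)
  then have "(\<lambda>k. (real k - 1) powr - \<beta>) \<longlonglongrightarrow> 0" using \<beta> by (intro tendsto_neg_powr) simp_all
  then have "E \<longlonglongrightarrow> 0" unfolding E_def by (rule tendsto_mult_right_zero)
  with \<phi>_lim have a_lim: "a \<longlonglongrightarrow> 0" unfolding a_def using tendsto_add[of \<phi> 0 _ E 0] by simp
  have pos: "0 \<le> a k" if k: "Suc K0 \<le> k" for k
  proof -
    have "a j \<le> a k" if "k \<le> j" for j
      using that
    proof (induction j rule: dec_induct)
      case (step j)
      have "a (Suc j) + \<kappa> * (step j)\<^sup>2 \<le> a j" using step.hyps k by (intro dec) simp
      moreover have "0 \<le> \<kappa> * (step j)\<^sup>2" using \<kappa> by simp
      ultimately show ?case using step.IH by linarith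
    qed simp
    then show ?thesis by (intro LIMSEQ_le_const2[OF a_lim]) auto
  qed
  obtain c \<eta> where c: "0 < c" and \<eta>: "0 < \<eta>" and KL: "\<And>y. y \<in> cball zlim \<eta> \<Longrightarrow>
      ereal (real_of_ereal \<bar>objF b n p f h y - objF b n p f h zlim\<bar> powr \<theta>)
        \<le> ereal c * (INF u\<in>frechet_subdiff (objF b n p f h) y. ereal (norm u))"
    using loj unfolding loj_exponent_def by blast
  have "\<forall>\<^sub>F k in sequentially. dist (zb k) zlim < \<eta>" using zb_lim \<eta> by (rule tendstoD)
  moreover have "\<forall>\<^sub>F k in sequentially. \<bar>\<phi> k\<bar> < 1" using tendstoD[OF \<phi>_lim, of 1] by simp
  ultimately have "\<forall>\<^sub>F k in sequentially. dist (zb k) zlim < \<eta> \<and> \<bar>\<phi> k\<bar> < 1" by eventually_elim simp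
  then obtain K1 where K1: "\<And>k. K1 \<le> k \<Longrightarrow> dist (zb k) zlim < \<eta> \<and> \<bar>\<phi> k\<bar> < 1"
    unfolding eventually_sequentially by blast
  define K where "K = Suc (max K0 K1)"
  have K: "1 \<le> K" "Suc K0 \<le> K" "K1 \<le> K" by (auto simp: K_def)
  define c1 where "c1 = c * (real n * (2 * L + M))"
  have c1: "0 \<le> c1" unfolding c1_def using c L_pos M_nonneg by simp
  have q_mono: "real (Suc k) powr - r \<le> real (Suc k) powr - q" if "q \<le> r" for r k
    using that by (intro powr_mono) auto
  have \<phi>_le: "\<bar>\<phi> (Suc k)\<bar> powr \<Theta> \<le> c1 * (step k + B * 2 powr l * real (Suc k) powr - q)"
    if k: "K \<le> k" for k
  \<comment> \<open>For \<open>\<theta> = 0\<close> the left side of the Lojasiewicz inequality is 0 or 1, and it still dominates the power with exponent \<open>\<Theta>\<close>.\<close>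
  proof (cases "\<phi> (Suc k) = 0")
    case True
    then show ?thesis using c1 B by simp
  next
    case False
    have "\<bar>\<phi> (Suc k)\<bar> powr \<Theta> \<le> \<bar>\<phi> (Suc k)\<bar> powr \<theta>"
      using False K1[of "Suc k"] k K \<Theta> by (intro powr_mono') auto
    also have "\<dots> \<le> c1 * (step k + B * real k powr - l)"
    proof -
      obtain u where u: "u \<in> frechet_subdiff (objF b n p f h) (zb (Suc k))"
        "norm u \<le> real n * (2 * L + M) * (step k + B * real k powr - l)"
        using small_subgradient[of k "B * real k powr - l"] zX \<Delta> \<Delta>' k K by auto
      have "ereal (\<bar>\<phi> (Suc k)\<bar> powr \<theta>)
          = ereal (real_of_ereal \<bar>objF b n p f h (zb (Suc k)) - objF b n p f h zlim\<bar> powr \<theta>)"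
        using exact_in_X[of "Suc k"] limX by (simp add: objF_eq \<phi>_def)
      also have "\<dots> \<le> ereal c * (INF u\<in>frechet_subdiff (objF b n p f h) (zb (Suc k)). ereal (norm u))"
        using K1[of "Suc k"] k K by (intro KL) (simp add: dist_commute)
      also have "\<dots> \<le> ereal c * ereal (norm u)"
        using c u by (intro ereal_mult_left_mono INF_lower) auto
      finally have "\<bar>\<phi> (Suc k)\<bar> powr \<theta> \<le> c * norm u" by simp
      also have "\<dots> \<le> c * (real n * (2 * L + M) * (step k + B * real k powr - l))"
        using c u by (intro mult_left_mono) auto
      finally show ?thesis by (simp add: c1_def mult.assoc)
    qed
    also have "\<dots> \<le> c1 * (step k + B * 2 powr l * real (Suc k) powr - q)"
    proof -
      have "real k powr - l \<le> 2 powr l * real (Suc k) powr - l"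
        using k K l_gt by (intro powr_neg_half) auto
      also have "\<dots> \<le> 2 powr l * real (Suc k) powr - q" using q_mono[OF ql] by simp
      finally have "B * real k powr - l \<le> B * (2 powr l * real (Suc k) powr - q)"
        using B by (rule mult_left_mono)
      then show ?thesis using c1 by (intro mult_left_mono) auto
    qed
    finally show ?thesis .
  qed
  have E_le: "E (Suc k) powr \<Theta> \<le> (A * 2 powr \<beta>) powr \<Theta> * real (Suc k) powr - q" if k: "K \<le> k" for k
  proof -
    have "E (Suc k) \<le> A * (2 powr \<beta> * real (Suc k) powr - \<beta>)"
      unfolding E_def using powr_neg_half[of k \<beta>] k K A \<beta> by (intro mult_left_mono) auto
    then have "E (Suc k) powr \<Theta> \<le> (A * 2 powr \<beta> * real (Suc k) powr - \<beta>) powr \<Theta>"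
      using A \<Theta> by (intro powr_mono2) (auto simp: E_def mult.assoc)
    also have "\<dots> = (A * 2 powr \<beta>) powr \<Theta> * real (Suc k) powr - (\<beta> * \<Theta>)"
      using A by (simp add: powr_mult powr_powr)
    also have "\<dots> \<le> (A * 2 powr \<beta>) powr \<Theta> * real (Suc k) powr - q"
    proof (intro mult_left_mono q_mono)
      \<comment> \<open>\<open>(2 * q - 1) * \<Theta> = q\<close>, so \<open>q \<le> l\<close> is what makes the tail \<open>E\<close> negligible.\<close>
      have "2 * q - 1 = 1 / (2 * \<Theta> - 1)" using \<Theta> by (simp add: q_def field_simps)
      then have "q = (2 * q - 1) * \<Theta>" by (simp add: q_def)
      also have "\<dots> \<le> \<beta> * \<Theta>" using ql \<Theta> by (intro mult_right_mono) (auto simp: \<beta>_def)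
      finally show "q \<le> \<beta> * \<Theta>" .
    qed simp
    finally show ?thesis .
  qed
  define c2 where "c2 = 2 * (c1 * (1 + B * 2 powr l) + (A * 2 powr \<beta>) powr \<Theta>) + 1"
  have c2: "0 < c2" unfolding c2_def using c1 B by (intro add_nonneg_pos mult_nonneg_nonneg add_nonneg_nonneg) auto
  have loj_a: "a (Suc k) powr \<Theta> \<le> c2 * (step k + real (Suc k) powr - (\<Theta> / (2 * \<Theta> - 1)))"
    if k: "K \<le> k" for k
  proof -
    let ?e = "real (Suc k) powr - q"
    have E0: "0 \<le> E (Suc k)" using A by (simp add: E_def)
    \<comment> \<open>Splitting the power of the sum at the larger summand costs a factor of at most 2.\<close>
    have "a (Suc k) powr \<Theta> \<le> (2 * max \<bar>\<phi> (Suc k)\<bar> (E (Suc k))) powr \<Theta>"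
      using pos[of "Suc k"] k K \<Theta> by (intro powr_mono2) (auto simp: a_def)
    also have "\<dots> = 2 powr \<Theta> * max \<bar>\<phi> (Suc k)\<bar> (E (Suc k)) powr \<Theta>"
      using E0 by (simp add: powr_mult)
    also have "\<dots> \<le> 2 powr 1 * (\<bar>\<phi> (Suc k)\<bar> powr \<Theta> + E (Suc k) powr \<Theta>)"
      using \<Theta> by (intro mult_mono powr_mono) (auto simp: max_def)
    also have "\<dots> \<le> 2 * (c1 * (step k + B * 2 powr l * ?e) + (A * 2 powr \<beta>) powr \<Theta> * ?e)"
      using \<phi>_le[OF k] E_le[OF k] by simp
    also have "\<dots> \<le> c2 * (step k + ?e)"
    proof -
      let ?D = "(A * 2 powr \<beta>) powr \<Theta>"
      have "0 \<le> 2 * (c1 * (B * 2 powr l) * step k + c1 * ?e + ?D * step k) + step k + ?e"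
        using c1 B by (intro add_nonneg_nonneg mult_nonneg_nonneg) auto
      then show ?thesis by (simp add: c2_def algebra_simps)
    qed
    finally show ?thesis by (simp add: q_def)
  qed
  have pos': "0 \<le> a k" if "K \<le> k" for k
    using that K by (intro pos) simp
  have dec': "a (Suc k) + \<kappa> * (step k)\<^sup>2 \<le> a k" if "K \<le> k" for k
    using that K by (intro dec) simp
  obtain C where C: "\<And>k. K \<le> k \<Longrightarrow> norm (zlim - zb k) \<le> C * real k powr - \<rho>"
    unfolding \<rho>_def
    using lojasiewicz_rate[where y = zb and a = a and K = K,
        OF \<kappa> c2 \<Theta>(2,3) K(1) zb_lim pos' dec' loj_a] by blast
  have "norm (z k - zlim) \<le> (B + C) * real k powr - \<rho>" if k: "K \<le> k" for k
  proof -
    have "real k powr - l \<le> real k powr - \<rho>"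
      using k K \<rho>q ql by (intro powr_mono) auto
    with B have "B * real k powr - l \<le> B * real k powr - \<rho>" by (rule mult_left_mono[rotated])
    moreover have "norm (zb k - z k) \<le> B * real k powr - l" using k K by (intro \<Delta>) simp
    moreover have "norm (z k - zlim) \<le> norm (zb k - z k) + norm (zlim - zb k)"
      using norm_triangle_ineq[of "zb k - z k" "zlim - zb k"] by (simp add: norm_minus_commute)
    ultimately show ?thesis using C[OF k] by (simp add: distrib_right)
  qed
  then show ?thesis unfolding \<rho>_def eventually_sequentially by blast
qed

end

theorem theorem5p3:
  fixes b :: "'d::finite \<Rightarrow> nat" and n :: nat and m p :: "nat \<Rightarrow> nat"
    and f :: "real ^ 'd \<Rightarrow> real" and h :: "nat \<Rightarrow> nat \<Rightarrow> real ^ 'd \<Rightarrow> real"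
    and Lc :: "nat \<Rightarrow> real" and L \<gamma> M \<epsilon>bar l \<theta> :: real
    and \<epsilon> :: "nat \<Rightarrow> real" and \<sigma> :: "nat \<Rightarrow> nat \<Rightarrow> real"
    and z zb :: "nat \<Rightarrow> real ^ 'd" and zb0 zlim :: "real ^ 'd"
    and F :: "real ^ 'd \<Rightarrow> ereal"
  assumes blocks: "block_structure b n m"
    and p_pos: "\<forall>i\<in>{1..n}. 0 < p i"
    and f_diff: "f differentiable_on UNIV"
    and h_convex: "\<forall>i\<in>{1..n}. \<forall>j\<in>{1..p i}. convex_on (blockspace b i) (h i j)"
    and h_diff: "\<forall>i\<in>{1..n}. \<forall>j\<in>{1..p i}. h i j differentiable_on blockspace b i"
    and F_def: "F = objF b n p f h"
    and \<epsilon>bar_pos: "0 < \<epsilon>bar" and l_gt: "1 < l"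
    and \<epsilon>_def: "\<forall>k. \<epsilon> k = \<epsilon>bar / (real k + 1) powr l"
    and L_def: "L = Max (Lc ` {1..n})"
    and \<gamma>_gt: "1 < \<gamma>" and M_ge: "\<gamma> * L \<le> M"
    and run: "palm_run b n p f h (\<gamma> * L) M \<epsilon> z \<sigma>"
    and zb0: "zb0 \<in> blockprod b n (feas b p h)"
    and zb_def: "zb = palm_exact b n p f h z \<sigma> zb0"
    and hyp1: "\<forall>i\<in>{1..n}. 0 < Lc i \<and>
        (\<forall>z1\<in>blockprod b n (feas_bar b p h \<epsilon>bar). \<forall>z2\<in>blockprod b n (feas_bar b p h \<epsilon>bar).
           norm (partial_grad b f i z1 - partial_grad b f i z2) \<le> Lc i * norm (z1 - z2))"
    and hyp2: "\<forall>i\<in>{1..n}. convex (feas b p h i) \<and> compact (feas b p h i) \<and>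
        (affine_constraint b p h i \<or> slater b p h i) \<and>
        (\<exists>c\<ge>0. \<forall>x\<in>feas_tilde b n p f h \<epsilon>bar (\<gamma> * L) i.
           infdist x (feas b p h i) \<le> c * L2_set (\<lambda>j. max (h i j x) 0) {1..p i})"
    and hyp3: "\<forall>x. stationary F x \<longrightarrow> loj_property F x"
    and hyp4: "\<exists>\<theta>bar. 0 < \<theta>bar \<and> \<theta>bar < 1 \<and> summable (\<lambda>k. (\<Sum>t. (\<epsilon> (k + t))\<^sup>2) powr \<theta>bar)"
      "summable \<epsilon>"
    and zlim: "\<forall>w. seq_limit_point z w \<longleftrightarrow> w = zlim"
    and \<theta>_exp: "loj_exponent F zlim \<theta>"
    and v_gt: "\<forall>k. lim (palm_v n L \<gamma> \<sigma> F z zb) < palm_v n L \<gamma> \<sigma> F z zb k"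
  shows "\<exists>C. \<forall>\<^sub>F k in sequentially. norm (z k - zlim) \<le> C *
           (if \<theta> / (2 * \<theta> - 1) \<le> l \<and> 1 / 2 < \<theta> \<and> \<theta> < 1
            then real k powr (- ((1 - \<theta>) / (2 * \<theta> - 1)))
            else real k powr (- (l - 1)))"
proof -
  interpret inexact_palm b n m p f h Lc L \<gamma> M \<epsilon>bar l \<epsilon> \<sigma> z zb zb0
  proof
    show "\<forall>i\<in>{1..n}. convex (feas b p h i) \<and> compact (feas b p h i) \<and>
        (\<exists>c\<ge>0. \<forall>x\<in>feas_tilde b n p f h \<epsilon>bar (\<gamma> * L) i.
           infdist x (feas b p h i) \<le> c * L2_set (\<lambda>j. max (h i j x) 0) {1..p i})"
      using hyp2 by blast
  qed fact+
  have uniq: "w = zlim" if "seq_limit_point z w" for w using zlim that by blast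
  have loj: "loj_exponent (objF b n p f h) zlim \<theta>" using \<theta>_exp F_def by simp
  show ?thesis
  proof (cases "\<theta> / (2 * \<theta> - 1) \<le> l \<and> 1 / 2 < \<theta> \<and> \<theta> < 1")
    case True
    then show ?thesis using exact_rate[OF uniq loj, of \<theta>] by simp
  next
    case False
    \<comment> \<open>The exponent for which the perturbation of order \<open>k powr - l\<close> is exactly critical.\<close>
    define \<Theta> where "\<Theta> = l / (2 * l - 1)"
    have e: "\<Theta> / (2 * \<Theta> - 1) = l" "(1 - \<Theta>) / (2 * \<Theta> - 1) = l - 1"
      using l_gt by (simp_all add: \<Theta>_def field_simps)
    have \<Theta>: "1 / 2 < \<Theta>" "\<Theta> < 1" using l_gt by (simp_all add: \<Theta>_def field_simps)
    have "\<theta> \<le> \<Theta>"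
    proof (cases "1 / 2 < \<theta>")
      case True
      moreover have "\<theta> < 1" using \<theta>_exp by (simp add: loj_exponent_def)
      ultimately have "l < \<theta> / (2 * \<theta> - 1)" using False by auto
      then show ?thesis using True l_gt by (simp add: \<Theta>_def field_simps)
    qed (use \<Theta> in simp)
    from exact_rate[OF uniq loj this \<Theta>] show ?thesis unfolding e if_not_P[OF False] by simp
  qed
qed

end
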